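(* Let $\alpha,\delta,\zeta,\eta\in\mathbb{R}$ and consider the projected edgewise-loss model of SH-SVL described in the context, where packets are lost on each edge with probability $p_\ell$, independently and identically distributed over edges and time. Let $m=|\mathcal E|$. Suppose there exist a symmetric $P\in\mathbb{R}^{(2n+m)\times(2n+m)}$, $\lambda_0\in\mathbb{R}$ and $\rho\in(0,1)$ with $P\succ 0$ and $\lambda_0\ge 0$ such that $$\sum_{\omega\in\Omega}p_\omega\,[\star]^\top\begin{bmatrix}P&0&0\\0&-\rho^2P&0\\0&0&\lambda_0(M_0\otimes I_n)\end{bmatrix}\begin{bmatrix}A_\omega&B_\omega\\ I&0\\ C&0\\ 0&I\end{bmatrix}\preceq 0 .$$ Then there is a fixed point $(w_1^\star,\hat w_2^\star,\hat{\bar\phi}^\star,x^\star,u^\star)$ of the model such that its trajectories satisfy, for all $k\ge0$, $$\mathbb{E}\left[\left\|\begin{bmatrix}w_1^k-w_1^\star\\ \hat w_2^k-\hat w_2^\star\\ \hat{\bar\phi}^k-\hat{\bar\phi}^\star\end{bmatrix}\right\|^2\right]\le\operatorname{cond}(P)\,\rho^{2k}\left\|\begin{bmatrix}w_1^0-w_1^\star\\ \hat w_2^0-\hat w_2^\star\\ \hat{\bar\phi}^0-\hat{\bar\phi}^\star\end{bmatrix}\right\|^2 .$$ Consequently the output $x^k$ of SH-SVL converges almost surely to the optimizer $\mathbf{1}x_{\rm opt}$ with linear rate $\rho$ (i.e. almost surely there is a finite random constant $c$ with $\|x^k-\mathbf{1}x_{\rm opt}\|\le c\,\rho^k$ for all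 $k$).
   Context: **Problem and standing assumptions.** $n$ agents; agent $i$ has a differentiable convex local cost $f_i:\mathbb{R}\to\mathbb{R}$ (the decision dimension is $d=1$). $x_{\rm opt}=\arg\min_\theta\sum_i f_i(\theta)$ is assumed unique and satisfies $\sum_i\nabla f_i(x_{\rm opt})=0$. Let $\mathbf{1}\in\mathbb{R}^n$ be the all-ones vector, $I$ an identity matrix, $\Pi=\frac1n\mathbf{1}\mathbf{1}^\top$; for $x\in\mathbb{R}^n$, $\nabla F(x)=(\nabla f_1(x_1),\dots,\nabla f_n(x_n))^\top$. $\|\cdot\|$ is the Euclidean vector norm / spectral matrix norm; $\operatorname{cond}(P)=\lambda_{\max}(P)/\lambda_{\min}(P)$ for symmetric $P$; $[\star]^\top A X$ means $X^\top A X$; $\otimes$ is the Kronecker product; $e_i$ is the $i$-th standard basis vector of the appropriate dimension; $D(A)$ is the diagonal matrix with the same diagonal as $A$. (A1) For given $0<\mu\le L$ and all $i$ and $x_i\in\mathbb{R}$, with $a=x_i-x_{\rm opt}$, $b=\nabla f_i(x_i)-\nabla f_i(x_{\rm opt})$: $-2\mu L a^2+2(L+\mu)ab-2b^2\ge0$. (A2) The communication graph $\mathcal G=(\{1,\dots,n\},\mathcal E)$, a weighted digraph (no self-loops) with $(i,j)\in\mathcal E$ meaning that $i$ can receive from $j$, is strongly connected. $\mathcal E$ is ordered by receiving index, then sending index. Its weighted Laplacian $\mathcal L\in\mathbb{R}^{n\times n}$ has $-\mathcal L_{ij}$ equal to the weight of edge $(i,j)$, $\mathcal L_{ij}=0$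 if $i\ne j$ and $(i,j)\notin\mathcal E$, $\mathcal L_{ii}=-\sum_{j\ne i}\mathcal L_{ij}$ (so $\mathcal L\mathbf{1}=0$). (A3) $\mathbf{1}^\top\mathcal L=0$. (A4) $\sigma:=\|I-\Pi-\mathcal L\|<1$. **SH-SVL.** With parameters $\alpha,\delta,\zeta,\eta$, each agent $i$ at time $k$ sends $y_i^k=\delta w_{1i}^k+\eta w_{2i}^k$; for each in-neighbor $j$ (and $j=i$) it sets $r_{ij}^k=y_j^k$ if the packet from $j$ is received (always the case for $j=i$) and $r_{ij}^k=\eta x_i^{k-1}+r_{ij}^{k-1}$ otherwise; then $v_i^k=\sum_j\mathcal L_{ij}r_{ij}^k$, $x_i^k=w_{1i}^k-v_i^k$ (its output, the estimate of the optimizer), $u_i^k=\nabla f_i(x_i^k)$, $w_{1i}^{k+1}=w_{1i}^k-\alpha u_i^k-\zeta v_i^k$, $w_{2i}^{k+1}=w_{1i}^k+w_{2i}^k-v_i^k$. **Projected edgewise-loss model.** Let $m=|\mathcal E|$ and let $\bar E\in\mathbb{R}^{n\times m}$ be the matrix whose $i$-th row has entry $\mathcal L_{ij}$ in the column of edge $(i,j)\in\mathcal E$ and $0$ in the columns of edges $(i',j)$ with $i'\neq i$. The state is $(w_1^k,\hat w_2^k,\hat{\bar\phi}^k)\in\mathbb{R}^n\times\mathbb{R}^n\times\mathbb{R}^m$, where $\hat{\bar\phi}^k=[\hat\phi^k_{(i,j)}]_{(i,j)\in\mathcal E}$, with deterministic initial state. The dynamics are $v^k=D(\mathcal L)(\delta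 w_1^k+\eta\hat w_2^k)+\bar E\hat{\bar\phi}^k$, $x^k=w_1^k-v^k$, $u^k=\nabla F(x^k)$, $w_1^{k+1}=w_1^k-\zeta v^k-\alpha u^k$, $\hat w_2^{k+1}=(I-\Pi)(w_1^k+\hat w_2^k-v^k)$, $\hat\phi_{(i,j)}^{k+1}=\delta w_{1j}^{k+1}+\eta\hat w_{2j}^{k+1}$ if edge $(i,j)$ succeeds, $\hat\phi_{(i,j)}^{k+1}=\hat\phi_{(i,j)}^k+\eta\,e_i^\top(I-\Pi)x^k$ if it fails. This is SH-SVL with $w_2$ projected onto the orthogonal complement of $\mathbf{1}$ and edge memories shifted accordingly; it has the same $w_1^k$ and $x^k$, and $x^k$ is the output of SH-SVL. Let $\omega^k\subseteq\mathcal E$ be the set of edges successful at time $k$; $\Omega$ is the collection of all $2^m$ subsets of $\mathcal E$, and $\mathbb{P}(\omega^k=\omega)=p_\omega=(1-p_\ell)^{|\omega|}p_\ell^{\,m-|\omega|}$, independently over $k$. A fixed point is a tuple $(w_1^\star,\hat w_2^\star,\hat{\bar\phi}^\star,x^\star,u^\star)$ with $x^\star=\mathbf{1}x_{\rm opt}$, $u^\star=\nabla F(x^\star)$, $w_1^\star=x^\star+v^\star$, that is left invariant by the dynamics of the projected edgewise-loss model for every $\omega\in\Omega$, that is, $v^\star=D(\mathcal L)(\delta w_1^\star+\eta\hat w_2^\star)+\bar E\hat{\bar\phi}^\star$, $w_1^\star=w_1^\star-\zeta v^\star-\alpha u^\star$, $\hat w_2^\star=(I-\Pi)(w_1^\star+\hat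 w_2^\star-v^\star)$, and, for every $\omega\in\Omega$, $\hat\phi^\star_{(i,j)}=\delta w_{1j}^\star+\eta\hat w_{2j}^\star$ for $(i,j)\in\omega$ and $\hat\phi^\star_{(i,j)}=\hat\phi^\star_{(i,j)}+\eta\,e_i^\top(I-\Pi)x^\star$ for $(i,j)\in\mathcal E\setminus\omega$, and with $\hat\phi^\star_{(i,j)}=\delta w_{1j}^\star+\eta\hat w_{2j}^\star$. **Matrices.** The dynamics read $\xi^{k+1}=A_{\omega^k}\xi^k+B_{\omega^k}u^k$, $x^k=C\xi^k$, $\xi=(w_1,\hat w_2,\hat{\bar\phi})$, where $A_\omega=\begin{bmatrix} A_1 \\ A_2 \\ A_{\omega\phi} \end{bmatrix}$, $B_\omega=\begin{bmatrix} -\alpha I \\ 0 \\ B_{\omega\phi} \end{bmatrix}$, $C=\begin{bmatrix}I-\delta D(\mathcal L)&-\eta D(\mathcal L)&-\bar E\end{bmatrix}$, $A_1=\begin{bmatrix}I-\zeta\delta D(\mathcal L)&-\zeta\eta D(\mathcal L)&-\zeta\bar E\end{bmatrix}$, $A_2=(I-\Pi)\begin{bmatrix}I-\delta D(\mathcal L)&I-\eta D(\mathcal L)&-\bar E\end{bmatrix}$, and the row of $[A_{\omega\phi}\;\,B_{\omega\phi}]$ for edge $\tau=(i,j)$ is $[a_1\;a_2\;a_\phi\;b]$ with: if $\tau\in\omega$: $a_1=e_j^\top[\delta(I-\zeta\delta D(\mathcal L))+\eta(I-\Pi)(I-\delta D(\mathcal L))]$, $a_2=e_j^\top[\eta(I-\Pi)(I-\eta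 D(\mathcal L))-\delta\zeta\eta D(\mathcal L)]$, $a_\phi=-e_j^\top(\delta\zeta I+\eta(I-\Pi))\bar E$, $b=-\alpha\delta e_j^\top$; if $\tau\notin\omega$: $a_1=\eta e_i^\top(I-\Pi)(I-\delta D(\mathcal L))$, $a_2=-\eta^2e_i^\top(I-\Pi)D(\mathcal L)$, $a_\phi=e_\tau^\top-\eta e_i^\top(I-\Pi)\bar E$, $b=0$. Finally $M_0=\begin{bmatrix}-2\mu L&L+\mu\\L+\mu&-2\end{bmatrix}$. *)

theory Defs
  imports "HOL-Probability.Probability"
begin

section \<open>Matrices\<close>

definition hcat :: "real^'a^'r \<Rightarrow> real^'b^'r \<Rightarrow> real^('a + 'b)^'r" where
  "hcat A B = (\<chi> r c. case c of Inl a \<Rightarrow> A $ r $ a | Inr b \<Rightarrow> B $ r $ b)"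

text \<open>Stacks matrices on top of each other and, with real entries, column vectors.\<close>

definition vcat :: "'c^'a \<Rightarrow> 'c^'b \<Rightarrow> 'c^('a + 'b)" where
  "vcat A B = (\<chi> r. case r of Inl a \<Rightarrow> A $ a | Inr b \<Rightarrow> B $ b)"

definition block_diag :: "real^'a^'a \<Rightarrow> real^'b^'b \<Rightarrow> real^('a + 'b)^('a + 'b)" where
  "block_diag A B = vcat (hcat A 0) (hcat 0 B)"

definition kron :: "real^'a^'b \<Rightarrow> real^'c^'d \<Rightarrow> real^('a \<times> 'c)^('b \<times> 'd)" where
  "kron A B = (\<chi> r c. A $ fst r $ fst c * B $ snd r $ snd c)"

text \<open>Two blocks of equal height stacked, with the rows indexed as those of \<open>kron A (mat 1)\<close>
  for a matrix \<open>A\<close> with two rows.\<close>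

definition vcat2 :: "'c^'n \<Rightarrow> 'c^'n \<Rightarrow> 'c^(2 \<times> 'n)" where
  "vcat2 A B = (\<chi> r. if fst r = 1 then A $ snd r else B $ snd r)"

definition diag_part :: "real^'n^'n \<Rightarrow> real^'n^'n" where
  "diag_part A = (\<chi> i j. if i = j then A $ i $ i else 0)"

definition avg :: "real^'n^'n" where
  "avg = (\<chi> i j. 1 / real CARD('n))"

definition symmetric_matrix :: "real^'n^'n \<Rightarrow> bool" where
  "symmetric_matrix A \<longleftrightarrow> transpose A = A"

definition pos_def :: "real^'n^'n \<Rightarrow> bool" where
  "pos_def A \<longleftrightarrow> symmetric_matrix A \<and> (\<forall>x. x \<noteq> 0 \<longrightarrow> 0 < x \<bullet> (A *v x))"

definition neg_semidef :: "real^'n^'n \<Rightarrow> bool" where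
  "neg_semidef A \<longleftrightarrow> symmetric_matrix A \<and> (\<forall>x. x \<bullet> (A *v x) \<le> 0)"

definition eigenvalues :: "real^'n^'n \<Rightarrow> real set" where
  "eigenvalues A = {l. \<exists>x. x \<noteq> 0 \<and> A *v x = l *\<^sub>R x}"

definition cond_number :: "real^'n^'n \<Rightarrow> real" where
  "cond_number A = Max (eigenvalues A) / Min (eigenvalues A)"

definition spectral_norm :: "real^'n^'m \<Rightarrow> real" where
  "spectral_norm A = onorm (\<lambda>x. A *v x)"


section \<open>Communication graph\<close>

text \<open>An edge \<open>(i, j)\<close> means that agent \<open>i\<close> can receive from agent \<open>j\<close>; \<open>a i j\<close> is its weight.\<close>

definition strongly_connected :: "('n \<times> 'n) set \<Rightarrow> bool" where
  "strongly_connected E \<longleftrightarrow> (\<forall>i j. (i, j) \<in> E\<^sup>*)"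

definition laplacian :: "('n::finite \<times> 'n) set \<Rightarrow> ('n \<Rightarrow> 'n \<Rightarrow> real) \<Rightarrow> real^'n^'n" where
  "laplacian E a = (\<chi> i j. if i = j then (\<Sum>k | (i, k) \<in> E. a i k)
                           else if (i, j) \<in> E then - a i j else 0)"

text \<open>Edge vectors carry one coordinate for every pair of agents; the coordinates outside \<open>E\<close>
  are junk. They have zero columns in \<open>Ebar\<close>, and \<open>restrict_vec\<close>, \<open>restrict_rows\<close> and
  \<open>restrict_cols\<close> below remove them.\<close>

definition Ebar :: "('n::finite \<times> 'n) set \<Rightarrow> real^'n^'n \<Rightarrow> real^('n \<times> 'n)^'n" where
  "Ebar E L = (\<chi> i t. if t \<in> E \<and> fst t = i then L $ i $ snd t else 0)"

definition loss_prob :: "('n \<times> 'n) set \<Rightarrow> real \<Rightarrow> ('n \<times> 'n) set \<Rightarrow> real" where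
  "loss_prob E pl w = (1 - pl) ^ card w * pl ^ (card E - card w)"

definition gradF :: "('n::finite \<Rightarrow> real \<Rightarrow> real) \<Rightarrow> real^'n \<Rightarrow> real^'n" where
  "gradF f x = (\<chi> i. deriv (f i) (x $ i))"


section \<open>SH-SVL\<close>

text \<open>The state at time \<open>k\<close> is \<open>(w\<^sub>1\<^sup>k, w\<^sub>2\<^sup>k, x\<^sup>k\<^sup>-\<^sup>1, r\<^sup>k\<^sup>-\<^sup>1)\<close>. In the functions below, \<open>S\<close> is
  the set of edges over which the packets sent at that time are received.\<close>

type_synonym 'n sh_state = "(real^'n) \<times> (real^'n) \<times> (real^'n) \<times> ('n \<Rightarrow> 'n \<Rightarrow> real)"

fun sh_r :: "real \<Rightarrow> real \<Rightarrow> ('n::finite \<times> 'n) set \<Rightarrow> 'n sh_state \<Rightarrow> 'n \<Rightarrow> 'n \<Rightarrow> real" where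
  "sh_r \<delta> \<eta> S (w1, w2, xp, rp) i j =
     (if j = i \<or> (i, j) \<in> S then \<delta> * w1 $ j + \<eta> * w2 $ j else \<eta> * xp $ i + rp i j)"

definition sh_v ::
  "('n::finite \<times> 'n) set \<Rightarrow> real^'n^'n \<Rightarrow> real \<Rightarrow> real \<Rightarrow> ('n \<times> 'n) set \<Rightarrow> 'n sh_state \<Rightarrow> real^'n"
where
  "sh_v E L \<delta> \<eta> S st = (\<chi> i. \<Sum>j | j = i \<or> (i, j) \<in> E. L $ i $ j * sh_r \<delta> \<eta> S st i j)"

definition sh_x ::
  "('n::finite \<times> 'n) set \<Rightarrow> real^'n^'n \<Rightarrow> real \<Rightarrow> real \<Rightarrow> ('n \<times> 'n) set \<Rightarrow> 'n sh_state \<Rightarrow> real^'n"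
where
  "sh_x E L \<delta> \<eta> S st = fst st - sh_v E L \<delta> \<eta> S st"

fun sh_step ::
  "('n::finite \<times> 'n) set \<Rightarrow> real^'n^'n \<Rightarrow> ('n \<Rightarrow> real \<Rightarrow> real) \<Rightarrow> real \<Rightarrow> real \<Rightarrow> real \<Rightarrow> real \<Rightarrow>
   ('n \<times> 'n) set \<Rightarrow> 'n sh_state \<Rightarrow> 'n sh_state"
where
  "sh_step E L f \<alpha> \<delta> \<zeta> \<eta> S (w1, w2, xp, rp) =
     (let st = (w1, w2, xp, rp);
          v = sh_v E L \<delta> \<eta> S st;
          x = sh_x E L \<delta> \<eta> S st;
          u = gradF f x
      in (w1 - \<alpha> *\<^sub>R u - \<zeta> *\<^sub>R v, w1 + w2 - v, x, sh_r \<delta> \<eta> S st))"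

primrec sh_run ::
  "('n::finite \<times> 'n) set \<Rightarrow> real^'n^'n \<Rightarrow> ('n \<Rightarrow> real \<Rightarrow> real) \<Rightarrow> real \<Rightarrow> real \<Rightarrow> real \<Rightarrow> real \<Rightarrow>
   (nat \<Rightarrow> ('n \<times> 'n) set) \<Rightarrow> 'n sh_state \<Rightarrow> nat \<Rightarrow> 'n sh_state"
where
  "sh_run E L f \<alpha> \<delta> \<zeta> \<eta> S st0 0 = st0"
| "sh_run E L f \<alpha> \<delta> \<zeta> \<eta> S st0 (Suc k) =
     sh_step E L f \<alpha> \<delta> \<zeta> \<eta> (S k) (sh_run E L f \<alpha> \<delta> \<zeta> \<eta> S st0 k)"

definition sh_output ::
  "('n::finite \<times> 'n) set \<Rightarrow> real^'n^'n \<Rightarrow> ('n \<Rightarrow> real \<Rightarrow> real) \<Rightarrow> real \<Rightarrow> real \<Rightarrow> real \<Rightarrow> real \<Rightarrow>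
   (nat \<Rightarrow> ('n \<times> 'n) set) \<Rightarrow> 'n sh_state \<Rightarrow> nat \<Rightarrow> real^'n"
where
  "sh_output E L f \<alpha> \<delta> \<zeta> \<eta> S st0 k =
     sh_x E L \<delta> \<eta> (S k) (sh_run E L f \<alpha> \<delta> \<zeta> \<eta> S st0 k)"


section \<open>Projected edgewise-loss model\<close>

text \<open>The state is \<open>(w\<^sub>1, w\<^sub>2, \<phi>)\<close> with \<open>w\<^sub>2\<close> the projected variable and \<open>\<phi>\<close> the shifted edge
  memories. The set \<open>w\<close> of successful edges acts in the update of \<open>\<phi>\<close>, so the set drawn at
  time \<open>k\<close> decides on the reception of the data of time \<open>k + 1\<close>.\<close>

type_synonym 'n pe_state = "(real^'n) \<times> (real^'n) \<times> (real^('n \<times> 'n))"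

fun pe_v ::
  "('n::finite \<times> 'n) set \<Rightarrow> real^'n^'n \<Rightarrow> real \<Rightarrow> real \<Rightarrow> 'n pe_state \<Rightarrow> real^'n"
where
  "pe_v E L \<delta> \<eta> (w1, w2, \<phi>) =
     diag_part L *v (\<delta> *\<^sub>R w1 + \<eta> *\<^sub>R w2) + Ebar E L *v \<phi>"

fun pe_step ::
  "('n::finite \<times> 'n) set \<Rightarrow> real^'n^'n \<Rightarrow> ('n \<Rightarrow> real \<Rightarrow> real) \<Rightarrow> real \<Rightarrow> real \<Rightarrow> real \<Rightarrow> real \<Rightarrow>
   ('n \<times> 'n) set \<Rightarrow> 'n pe_state \<Rightarrow> 'n pe_state"
where
  "pe_step E L f \<alpha> \<delta> \<zeta> \<eta> w (w1, w2, \<phi>) =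
     (let v = pe_v E L \<delta> \<eta> (w1, w2, \<phi>);
          x = w1 - v;
          u = gradF f x;
          w1' = w1 - \<zeta> *\<^sub>R v - \<alpha> *\<^sub>R u;
          w2' = (mat 1 - avg) *v (w1 + w2 - v);
          \<phi>' = (\<chi> t. case t of (i, j) \<Rightarrow>
                 if (i, j) \<in> w then \<delta> * w1' $ j + \<eta> * w2' $ j
                 else \<phi> $ (i, j) + \<eta> * ((mat 1 - avg) *v x) $ i)
      in (w1', w2', \<phi>'))"

primrec pe_run ::
  "('n::finite \<times> 'n) set \<Rightarrow> real^'n^'n \<Rightarrow> ('n \<Rightarrow> real \<Rightarrow> real) \<Rightarrow> real \<Rightarrow> real \<Rightarrow> real \<Rightarrow> real \<Rightarrow>
   (nat \<Rightarrow> ('n \<times> 'n) set) \<Rightarrow> 'n pe_state \<Rightarrow> nat \<Rightarrow> 'n pe_state"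
where
  "pe_run E L f \<alpha> \<delta> \<zeta> \<eta> w st0 0 = st0"
| "pe_run E L f \<alpha> \<delta> \<zeta> \<eta> w st0 (Suc k) =
     pe_step E L f \<alpha> \<delta> \<zeta> \<eta> (w k) (pe_run E L f \<alpha> \<delta> \<zeta> \<eta> w st0 k)"

definition pe_fixed_point ::
  "('n::finite \<times> 'n) set \<Rightarrow> real^'n^'n \<Rightarrow> ('n \<Rightarrow> real \<Rightarrow> real) \<Rightarrow> real \<Rightarrow> real \<Rightarrow> real \<Rightarrow> real \<Rightarrow> real \<Rightarrow>
   real^'n \<Rightarrow> real^'n \<Rightarrow> real^('n \<times> 'n) \<Rightarrow> real^'n \<Rightarrow> real^'n \<Rightarrow> bool"
where
  "pe_fixed_point E L f xopt \<alpha> \<delta> \<zeta> \<eta> w1 w2 \<phi> x u \<longleftrightarrow>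
     (let v = pe_v E L \<delta> \<eta> (w1, w2, \<phi>)
      in x = vec xopt \<and> u = gradF f x \<and> w1 = x + v \<and>
         w1 = w1 - \<zeta> *\<^sub>R v - \<alpha> *\<^sub>R u \<and>
         w2 = (mat 1 - avg) *v (w1 + w2 - v) \<and>
         (\<forall>w\<in>Pow E.
            (\<forall>(i, j)\<in>w. \<phi> $ (i, j) = \<delta> * w1 $ j + \<eta> * w2 $ j) \<and>
            (\<forall>(i, j)\<in>E - w. \<phi> $ (i, j) = \<phi> $ (i, j) + \<eta> * ((mat 1 - avg) *v x) $ i)) \<and>
         (\<forall>(i, j)\<in>E. \<phi> $ (i, j) = \<delta> * w1 $ j + \<eta> * w2 $ j))"


section \<open>Coordinates of the stacked state\<close>

text \<open>The stacked state has \<open>2n + m\<close> coordinates, where \<open>m\<close> is the number of edges in \<open>E\<close>. They are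
  indexed by a finite type \<open>'s\<close> with a numbering \<open>idx\<close>: every coordinate is assigned an agent
  (first block), an agent (second block) or an edge in \<open>E\<close> (third block). The existence of the
  bijection fixes the cardinality of \<open>'s\<close> to be \<open>2n + m\<close>, and \<open>E\<close> may be empty.\<close>

type_synonym 'n coord = "'n + 'n + ('n \<times> 'n)"

definition state_numbering :: "('n \<times> 'n) set \<Rightarrow> ('s \<Rightarrow> 'n coord) \<Rightarrow> bool" where
  "state_numbering E idx \<longleftrightarrow> bij_betw idx UNIV (UNIV <+> (UNIV <+> E))"

definition restrict_vec :: "('s \<Rightarrow> 'c) \<Rightarrow> real^'c \<Rightarrow> real^'s" where
  "restrict_vec idx x = (\<chi> s. x $ idx s)"

definition restrict_rows :: "('s \<Rightarrow> 'c) \<Rightarrow> real^'a^'c \<Rightarrow> real^'a^'s" where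
  "restrict_rows idx A = (\<chi> s a. A $ idx s $ a)"

definition restrict_cols :: "('s \<Rightarrow> 'c) \<Rightarrow> real^'c^'a \<Rightarrow> real^'s^'a" where
  "restrict_cols idx A = (\<chi> a s. A $ a $ idx s)"

fun stack :: "('s::finite \<Rightarrow> 'n coord) \<Rightarrow> 'n::finite pe_state \<Rightarrow> real^'s" where
  "stack idx (w1, w2, \<phi>) = restrict_vec idx (vcat w1 (vcat w2 \<phi>))"


section \<open>Matrices of the linear matrix inequality\<close>

definition A1 ::
  "('n::finite \<times> 'n) set \<Rightarrow> real^'n^'n \<Rightarrow> real \<Rightarrow> real \<Rightarrow> real \<Rightarrow> real^('n coord)^'n"
where
  "A1 E L \<delta> \<zeta> \<eta> =
     hcat (mat 1 - (\<zeta> * \<delta>) *\<^sub>R diag_part L)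
       (hcat (- (\<zeta> * \<eta>) *\<^sub>R diag_part L) (- \<zeta> *\<^sub>R Ebar E L))"

definition A2 ::
  "('n::finite \<times> 'n) set \<Rightarrow> real^'n^'n \<Rightarrow> real \<Rightarrow> real \<Rightarrow> real^('n coord)^'n"
where
  "A2 E L \<delta> \<eta> =
     (mat 1 - avg) **
       hcat (mat 1 - \<delta> *\<^sub>R diag_part L) (hcat (mat 1 - \<eta> *\<^sub>R diag_part L) (- Ebar E L))"

text \<open>Here \<open>row i A\<close> is the product of the transposed \<open>i\<close>-th standard basis vector with \<open>A\<close>.\<close>

definition A_phi ::
  "('n::finite \<times> 'n) set \<Rightarrow> real^'n^'n \<Rightarrow> real \<Rightarrow> real \<Rightarrow> real \<Rightarrow> ('n \<times> 'n) set \<Rightarrow>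
   real^('n coord)^('n \<times> 'n)"
where
  "A_phi E L \<delta> \<zeta> \<eta> w =
     (\<chi> t. case t of (i, j) \<Rightarrow>
       if t \<in> w then
         vcat (row j (\<delta> *\<^sub>R (mat 1 - (\<zeta> * \<delta>) *\<^sub>R diag_part L)
                      + \<eta> *\<^sub>R ((mat 1 - avg) ** (mat 1 - \<delta> *\<^sub>R diag_part L))))
           (vcat (row j (\<eta> *\<^sub>R ((mat 1 - avg) ** (mat 1 - \<eta> *\<^sub>R diag_part L))
                         - (\<delta> * \<zeta> * \<eta>) *\<^sub>R diag_part L))
             (- row j (((\<delta> * \<zeta>) *\<^sub>R mat 1 + \<eta> *\<^sub>R (mat 1 - avg)) ** Ebar E L)))
       else
         vcat (\<eta> *\<^sub>R row i ((mat 1 - avg) ** (mat 1 - \<delta> *\<^sub>R diag_part L)))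
           (vcat (- (\<eta>\<^sup>2) *\<^sub>R row i ((mat 1 - avg) ** diag_part L))
             (axis t 1 - \<eta> *\<^sub>R row i ((mat 1 - avg) ** Ebar E L))))"

definition B_phi :: "real \<Rightarrow> real \<Rightarrow> ('n::finite \<times> 'n) set \<Rightarrow> real^'n^('n \<times> 'n)" where
  "B_phi \<alpha> \<delta> w =
     (\<chi> t. case t of (i, j) \<Rightarrow> if t \<in> w then - (\<alpha> * \<delta>) *\<^sub>R axis j 1 else 0)"

definition A_mat ::
  "('s::finite \<Rightarrow> 'n coord) \<Rightarrow> ('n::finite \<times> 'n) set \<Rightarrow> real^'n^'n \<Rightarrow> real \<Rightarrow> real \<Rightarrow> real \<Rightarrow>
   ('n \<times> 'n) set \<Rightarrow> real^'s^'s"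
where
  "A_mat idx E L \<delta> \<zeta> \<eta> w =
     restrict_rows idx (restrict_cols idx
       (vcat (A1 E L \<delta> \<zeta> \<eta>) (vcat (A2 E L \<delta> \<eta>) (A_phi E L \<delta> \<zeta> \<eta> w))))"

definition B_mat ::
  "('s::finite \<Rightarrow> 'n coord) \<Rightarrow> real \<Rightarrow> real \<Rightarrow> ('n::finite \<times> 'n) set \<Rightarrow> real^'n^'s"
where
  "B_mat idx \<alpha> \<delta> w = restrict_rows idx (vcat (- \<alpha> *\<^sub>R mat 1) (vcat 0 (B_phi \<alpha> \<delta> w)))"

definition C_mat ::
  "('s::finite \<Rightarrow> 'n coord) \<Rightarrow> ('n::finite \<times> 'n) set \<Rightarrow> real^'n^'n \<Rightarrow> real \<Rightarrow> real \<Rightarrow> real^'s^'n"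
where
  "C_mat idx E L \<delta> \<eta> =
     restrict_cols idx
       (hcat (mat 1 - \<delta> *\<^sub>R diag_part L) (hcat (- \<eta> *\<^sub>R diag_part L) (- Ebar E L)))"

definition M0 :: "real \<Rightarrow> real \<Rightarrow> real^2^2" where
  "M0 \<mu> l = vector [vector [- 2 * \<mu> * l, l + \<mu>], vector [l + \<mu>, - 2]]"

definition lmi_inner ::
  "real \<Rightarrow> real \<Rightarrow> real \<Rightarrow> real \<Rightarrow> real^'s::finite^'s \<Rightarrow>
   real^('s + 's + (2 \<times> 'n))^('s + 's + (2 \<times> 'n::finite))"
where
  "lmi_inner \<mu> l \<rho> lam0 P =
     block_diag P (block_diag (- (\<rho>\<^sup>2) *\<^sub>R P) (lam0 *\<^sub>R kron (M0 \<mu> l) (mat 1 :: real^'n^'n)))"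

definition lmi_outer ::
  "('s::finite \<Rightarrow> 'n coord) \<Rightarrow> ('n::finite \<times> 'n) set \<Rightarrow> real^'n^'n \<Rightarrow> real \<Rightarrow> real \<Rightarrow> real \<Rightarrow> real \<Rightarrow>
   ('n \<times> 'n) set \<Rightarrow> real^('s + 'n)^('s + 's + (2 \<times> 'n))"
where
  "lmi_outer idx E L \<alpha> \<delta> \<zeta> \<eta> w =
     vcat (hcat (A_mat idx E L \<delta> \<zeta> \<eta> w) (B_mat idx \<alpha> \<delta> w))
       (vcat (hcat (mat 1) 0)
         (vcat2 (hcat (C_mat idx E L \<delta> \<eta>) 0) (hcat 0 (mat 1))))"

definition lmi_matrix ::
  "('s::finite \<Rightarrow> 'n coord) \<Rightarrow> ('n::finite \<times> 'n) set \<Rightarrow> real^'n^'n \<Rightarrow> real \<Rightarrow> real \<Rightarrow> real \<Rightarrow>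
   real \<Rightarrow> real \<Rightarrow> real \<Rightarrow> real \<Rightarrow> real \<Rightarrow> real \<Rightarrow> real^'s^'s \<Rightarrow> real^('s + 'n)^('s + 'n)"
where
  "lmi_matrix idx E L pl \<mu> l \<alpha> \<delta> \<zeta> \<eta> \<rho> lam0 P =
     (\<Sum>w\<in>Pow E. loss_prob E pl w *\<^sub>R
        (transpose (lmi_outer idx E L \<alpha> \<delta> \<zeta> \<eta> w) ** lmi_inner \<mu> l \<rho> lam0 P
           ** lmi_outer idx E L \<alpha> \<delta> \<zeta> \<eta> w))"

end

theory Submission
  imports Defs
begin

text \<open>
  The function \<open>V(\<xi>) = (\<xi> - \<xi>\<^sup>\<star>)\<^sup>T P (\<xi> - \<xi>\<^sup>\<star>)\<close> is a stochastic Lyapunov function of the projected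
  model. Multiplying the matrix inequality from both sides by the vector \<open>(e, u)\<close> gives, for every
  state deviation \<open>e\<close> and every input deviation \<open>u\<close>,
  \<open>E V(next state) - \<rho>\<^sup>2 V(state) + \<lambda>\<^sub>0 (sector term) \<le> 0\<close> (\<open>lmi_dissipation\<close>). Along the dynamics
  the input is the gradient, for which the sector term is nonnegative. So the expectation of \<open>V\<close>
  contracts by \<open>\<rho>\<^sup>2\<close> in each step, because the edge draw of a step is independent of the state before
  it (\<open>expectation_traj_Suc\<close>). The extreme eigenvalues of \<open>P\<close> compare \<open>V\<close> with the squared norm and
  produce the factor \<open>cond P\<close>.

  The almost sure statement has the same rate \<open>\<rho>\<close>, which summing the expectations \<open>E V(\<xi>\<^sup>k) \<le> c \<rho>\<^sup>2\<^sup>k\<close>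
  does not give: it would lose an arbitrarily small amount of the rate. Instead,
  \<open>V(\<xi>\<^sup>k) / \<rho>\<^sup>2\<^sup>k\<close> is a nonnegative supermartingale, and the maximal inequality for such processes
  bounds its supremum almost surely (\<open>AE_traj_bounded\<close>).

  A fixed point must have \<open>\<zeta> v\<^sup>\<star> = - \<alpha> u\<^sup>\<star>\<close> and \<open>(I - \<delta> L) v\<^sup>\<star> = \<eta> L w\<^sub>2\<^sup>\<star>\<close>, which need not be
  solvable if \<open>\<zeta> = 0\<close> or \<open>\<eta> = 0\<close>. The matrix inequality excludes these cases whenever
  \<open>u\<^sup>\<star> \<noteq> 0\<close>: for each of them the linear dynamics without input has a nonzero invariant
  state with output \<open>0\<close>, which contradicts the contraction (\<open>equilibrium_exists\<close>). The
  remaining linear equation is solvable since \<open>L + \<Pi>\<close> is invertible (\<open>balanced_solution\<close>).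

  Finally, SH-SVL and the projected model have the same output, because subtracting the mean of
  \<open>w\<^sub>2\<close> from \<open>w\<^sub>2\<close> and \<open>\<eta>\<close> times this mean from the edge memories turns one recursion into the
  other (\<open>sh_output_eq_pe_x\<close>).
\<close>

section \<open>Iterations driven by independent draws\<close>

primrec iterate :: "('b \<Rightarrow> 'a \<Rightarrow> 'a) \<Rightarrow> (nat \<Rightarrow> 'b) \<Rightarrow> 'a \<Rightarrow> nat \<Rightarrow> 'a" where
  "iterate F w x 0 = x"
| "iterate F w x (Suc k) = F (w k) (iterate F w x k)"

lemma iterate_cong:
  assumes "\<And>j. j < k \<Longrightarrow> w j = w' j"
  shows "iterate F w x k = iterate F w' x k"
  using assms by (induction k) auto

text \<open>The update map is fixed and only its parameter is random. The draws take finitely many values, so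
  a trajectory with a deterministic initial state has a finite range at each time. Hence every real
  function of it is measurable and integrable, whatever the type of the states.\<close>

locale iid_draws = prob_space M for M :: "'w measure" +
  fixes om :: "nat \<Rightarrow> 'w \<Rightarrow> 'b" and S :: "'b set" and p :: "'b \<Rightarrow> real"
  assumes finite_draws: "finite S"
    and indep_draws: "indep_vars (\<lambda>_. count_space S) om UNIV"
    and distr_draws: "\<And>k w. w \<in> S \<Longrightarrow> prob {s \<in> space M. om k s = w} = p w"
begin

abbreviation traj :: "('b \<Rightarrow> 'a \<Rightarrow> 'a) \<Rightarrow> 'a \<Rightarrow> nat \<Rightarrow> 'w \<Rightarrow> 'a" where
  "traj F x k s \<equiv> iterate F (\<lambda>j. om j s) x k"

lemma draws_rv: "random_variable (count_space S) (om k)"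
  using indep_draws by (auto simp: indep_vars_def)

lemma draws_in: "s \<in> space M \<Longrightarrow> om k s \<in> S"
  using measurable_space[OF draws_rv] by auto

lemma draw_event: "w \<in> S \<Longrightarrow> {s \<in> space M. om k s = w} \<in> events"
proof -
  assume "w \<in> S"
  then have "om k -` {w} \<inter> space M \<in> events"
    by (intro measurable_sets[OF draws_rv]) auto
  also have "om k -` {w} \<inter> space M = {s \<in> space M. om k s = w}" by auto
  finally show ?thesis .
qed

lemma sum_p: "(\<Sum>w\<in>S. p w) = 1"
proof -
  have "(\<Sum>w\<in>S. p w) = (\<Sum>w\<in>S. prob {s \<in> space M. om 0 s = w})"
    by (simp add: distr_draws)
  also have "\<dots> = prob (\<Union>w\<in>S. {s \<in> space M. om 0 s = w})"
    by (intro finite_measure_finite_Union[symmetric] finite_draws)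
       (auto simp: draw_event disjoint_family_on_def)
  also have "(\<Union>w\<in>S. {s \<in> space M. om 0 s = w}) = space M"
    using draws_in by auto
  finally show ?thesis by (simp add: prob_space)
qed

lemma PiM_draws: "finite A \<Longrightarrow> PiM A (\<lambda>_. count_space S) = count_space (PiE A (\<lambda>_. S))"
  by (intro count_space_PiM_finite) (auto simp: finite_draws countable_finite)

text \<open>A state at time \<open>k\<close> depends on the draws before time \<open>k\<close> only. This is the source of both its
  measurability and its independence of the draw at time \<open>k\<close>.\<close>

lemma traj_eq_restrict: "traj F x k = (\<lambda>v. iterate F v x k) \<circ> (\<lambda>s. \<lambda>i\<in>{..<k}. om i s)"
  by (auto simp: fun_eq_iff intro!: iterate_cong)

lemma traj_rv [measurable]: "traj F x k \<in> measurable M (count_space UNIV)"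
proof -
  have "(\<lambda>s. \<lambda>i\<in>{..<k}. om i s) \<in> measurable M (PiM {..<k} (\<lambda>_. count_space S))"
    by (intro measurable_restrict draws_rv)
  then show ?thesis
    unfolding traj_eq_restrict by (rule measurable_comp) (simp add: PiM_draws)
qed

lemma indep_draw_traj:
  fixes g :: "'b \<Rightarrow> real" and h :: "'a \<Rightarrow> real"
  shows "indep_var borel (\<lambda>s. g (om k s)) borel (\<lambda>s. h (traj F x k s))"
proof -
  have "indep_var borel ((\<lambda>v. g (v k)) \<circ> (\<lambda>s. \<lambda>i\<in>{k}. om i s))
      borel ((\<lambda>v. h (iterate F v x k)) \<circ> (\<lambda>s. \<lambda>i\<in>{..<k}. om i s))"
    by (rule indep_var_compose[OF indep_var_restrict[OF indep_draws]]) (auto simp: PiM_draws)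
  then show ?thesis
    using traj_eq_restrict[of F x k] by (simp add: comp_def fun_eq_iff)
qed

lemma finite_traj: "finite (traj F x k ` space M)"
proof -
  have "traj F x k ` space M \<subseteq> (\<lambda>v. iterate F v x k) ` PiE {..<k} (\<lambda>_. S)"
  proof safe
    fix s assume "s \<in> space M"
    then show "traj F x k s \<in> (\<lambda>v. iterate F v x k) ` PiE {..<k} (\<lambda>_. S)"
      by (intro image_eqI[where x = "\<lambda>i\<in>{..<k}. om i s"] iterate_cong) (auto simp: draws_in)
  qed
  then show ?thesis
    by (rule finite_subset) (intro finite_imageI finite_PiE, auto simp: finite_draws)
qed

lemma integrable_traj:
  fixes G :: "'a \<Rightarrow> real"
  shows "integrable M (\<lambda>s. G (traj F x k s))"
proof -
  obtain B where B: "\<And>y. y \<in> traj F x k ` space M \<Longrightarrow> \<bar>G y\<bar> \<le> B"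
    using finite_imageI[OF finite_traj, of "\<lambda>y. \<bar>G y\<bar>"] bdd_above_finite
    by (metis bdd_above.unfold imageI)
  have "G \<in> borel_measurable (count_space UNIV)" by simp
  then have "(\<lambda>s. G (traj F x k s)) \<in> borel_measurable M"
    by (rule measurable_compose[OF traj_rv])
  then show ?thesis
    using B by (intro integrable_const_bound[where B = B] AE_I2) auto
qed

text \<open>The tower property of conditional expectation, in the elementary form that finitely many
  draws allow: split by the value of the draw, then use independence.\<close>

lemma expectation_traj_Suc:
  fixes G :: "'a \<Rightarrow> real"
  shows "expectation (\<lambda>s. G (traj F x (Suc k) s))
    = (\<Sum>w\<in>S. p w * expectation (\<lambda>s. G (F w (traj F x k s))))"
proof -
  define d :: "'b \<Rightarrow> 'w \<Rightarrow> real" where "d w s = indicator {w} (om k s)" for w s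
  have indep: "indep_var borel (d w) borel (\<lambda>s. G (F w (traj F x k s)))" for w
    unfolding d_def by (rule indep_draw_traj)
  have d_event: "expectation (d w) = p w \<and> integrable M (d w)" if "w \<in> S" for w
  proof -
    have "expectation (d w) = expectation (indicator {s \<in> space M. om k s = w})"
      by (intro Bochner_Integration.integral_cong) (auto simp: indicator_def d_def)
    moreover have "integrable M (d w) \<longleftrightarrow> integrable M (indicator {s \<in> space M. om k s = w} :: 'w \<Rightarrow> real)"
      by (intro Bochner_Integration.integrable_cong) (auto simp: indicator_def d_def)
    moreover have "integrable M (indicator {s \<in> space M. om k s = w} :: 'w \<Rightarrow> real)"
      using draw_event[OF that] by (simp add: integrable_indicator_iff emeasure_eq_measure)
    ultimately show ?thesis using that by (simp add: draw_event distr_draws)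
  qed
  have "expectation (\<lambda>s. G (traj F x (Suc k) s))
      = expectation (\<lambda>s. \<Sum>w\<in>S. d w s * G (F w (traj F x k s)))"
  proof (intro Bochner_Integration.integral_cong refl)
    fix s assume "s \<in> space M"
    have "(\<Sum>w\<in>S. d w s * G (F w (traj F x k s)))
        = (\<Sum>w\<in>S. if w = om k s then G (F w (traj F x k s)) else 0)"
      by (intro sum.cong) (auto simp: d_def)
    also have "\<dots> = G (traj F x (Suc k) s)"
      using draws_in[OF \<open>s \<in> space M\<close>, of k] by (simp add: finite_draws)
    finally show "G (traj F x (Suc k) s) = (\<Sum>w\<in>S. d w s * G (F w (traj F x k s)))" ..
  qed
  also have "\<dots> = (\<Sum>w\<in>S. expectation (\<lambda>s. d w s * G (F w (traj F x k s))))"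
    by (intro Bochner_Integration.integral_sum indep_var_integrable indep
        conjunct2[OF d_event] integrable_traj[of "\<lambda>y. G (F _ y)"])
  also have "\<dots> = (\<Sum>w\<in>S. p w * expectation (\<lambda>s. G (F w (traj F x k s))))"
    by (intro sum.cong refl)
      (simp add: d_event integrable_traj[of "\<lambda>y. G (F _ y)"] indep_var_lebesgue_integral[OF indep])
  finally show ?thesis .
qed

lemma expectation_traj_le:
  fixes G :: "'a \<Rightarrow> real"
  assumes drift: "\<And>y. (\<Sum>w\<in>S. p w * G (F w y)) \<le> c * G y" and "0 \<le> c"
  shows "expectation (\<lambda>s. G (traj F x k s)) \<le> c ^ k * G x"
proof (induction k)
  case 0
  show ?case by (simp add: prob_space)
next
  case (Suc k)
  have "expectation (\<lambda>s. G (traj F x (Suc k) s))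
      = expectation (\<lambda>s. \<Sum>w\<in>S. p w * G (F w (traj F x k s)))"
    unfolding expectation_traj_Suc
    by (subst Bochner_Integration.integral_sum)
       (auto intro!: integrable_traj[of "\<lambda>y. G (F _ y)"] simp del: iterate.simps)
  also have "\<dots> \<le> expectation (\<lambda>s. c * G (traj F x k s))"
    by (intro integral_mono integrable_traj[of "\<lambda>y. \<Sum>w\<in>S. p w * G (F w y)"]
        integrable_traj[of "\<lambda>y. c * G y"] drift)
  also have "\<dots> \<le> c * (c ^ k * G x)"
    using Suc \<open>0 \<le> c\<close> by (simp add: mult_left_mono)
  finally show ?case by (simp add: mult.assoc)
qed

text \<open>Ville's inequality for the supermartingale \<open>V(X\<^sub>k) / c\<^sup>k\<close>. The process stopped at the first time
  at which it reaches \<open>a\<close> is again such an iteration, on pairs of a time and a state: the map \<open>H\<close> below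
  leaves the pair unchanged once the level is reached. So the expectation bound applies to it, and
  Markov's inequality at the single time \<open>K\<close> controls all times up to \<open>K\<close>.\<close>

lemma maximal_inequality:
  fixes V :: "'a \<Rightarrow> real"
  assumes V: "\<And>y. 0 \<le> V y" and drift: "\<And>y. (\<Sum>w\<in>S. p w * V (F w y)) \<le> c * V y"
    and "0 < c" "0 < a"
  shows "prob {s \<in> space M. \<exists>k\<le>K. a * c ^ k \<le> V (traj F x k s)} \<le> V x / a"
proof -
  define H where "H w = (\<lambda>(k, y). if a * c ^ k \<le> V y then (k, y) else (Suc k, F w y))" for w
  define G where "G = (\<lambda>(k, y). V y / c ^ k)"
  have G0: "0 \<le> G z" for z
    using V \<open>0 < c\<close> by (auto simp: G_def split: prod.split)
  have "(\<Sum>w\<in>S. p w * G (H w z)) \<le> 1 * G z" for z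
  proof (cases z)
    case (Pair k y)
    show ?thesis
    proof (cases "a * c ^ k \<le> V y")
      case True
      then show ?thesis by (simp add: Pair H_def sum_p flip: sum_distrib_right)
    next
      case False
      have "(\<Sum>w\<in>S. p w * G (H w z)) = (\<Sum>w\<in>S. p w * V (F w y)) / c ^ Suc k"
        using False by (simp add: Pair H_def G_def sum_divide_distrib)
      also have "\<dots> \<le> c * V y / c ^ Suc k"
        using drift \<open>0 < c\<close> by (intro divide_right_mono) auto
      also have "\<dots> = 1 * G z" using \<open>0 < c\<close> by (simp add: Pair G_def)
      finally show ?thesis .
    qed
  qed
  then have EG: "expectation (\<lambda>s. G (traj H (0, x) K s)) \<le> 1 ^ K * G (0, x)"
    by (rule expectation_traj_le) auto
  have H_stop: "H w z = z" if "a \<le> G z" for w z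
    using that \<open>0 < c\<close> by (auto simp: H_def G_def field_simps split: prod.splits)
  have H_step: "H w (k, y) = (Suc k, F w y) \<and> V y < a * c ^ k" if "\<not> a \<le> G (k, y)" for w k y
    using that \<open>0 < c\<close> by (auto simp: H_def G_def field_simps)
  have stopped: "a \<le> G (traj H (0, x) K s) \<or>
      (traj H (0, x) K s = (K, traj F x K s) \<and> (\<forall>k<K. V (traj F x k s) < a * c ^ k))" for s
  proof (induction K)
    case (Suc K)
    then show ?case
      using H_stop[of "traj H (0, x) K s" "om K s"] H_step[of K "traj F x K s" "om K s"]
      by (cases "a \<le> G (traj H (0, x) K s)") (auto simp: less_Suc_eq)
  qed simp
  have "{s \<in> space M. \<exists>k\<le>K. a * c ^ k \<le> V (traj F x k s)} \<subseteq> {s \<in> space M. a \<le> G (traj H (0, x) K s)}"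
  proof safe
    fix s k assume k: "k \<le> K" "a * c ^ k \<le> V (traj F x k s)"
    show "a \<le> G (traj H (0, x) K s)"
      using stopped[of s] k \<open>0 < c\<close> by (auto simp: G_def field_simps le_less)
  qed
  then have "prob {s \<in> space M. \<exists>k\<le>K. a * c ^ k \<le> V (traj F x k s)}
      \<le> prob {s \<in> space M. a \<le> G (traj H (0, x) K s)}"
    by (intro finite_measure_mono) measurable
  also have "\<dots> \<le> expectation (\<lambda>s. G (traj H (0, x) K s)) / a"
    using G0 \<open>0 < a\<close> by (intro integral_Markov_inequality_measure[where A = "{}"] integrable_traj) auto
  also have "\<dots> \<le> V x / a"
    using EG \<open>0 < a\<close> by (intro divide_right_mono) (auto simp: G_def)
  finally show ?thesis .
qed

text \<open>The probability that the supermartingale reaches the level \<open>N + 1\<close> at some time tends to \<open>0\<close>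
  as \<open>N\<close> grows.\<close>

lemma AE_traj_bounded:
  fixes V :: "'a \<Rightarrow> real"
  assumes V: "\<And>y. 0 \<le> V y" and drift: "\<And>y. (\<Sum>w\<in>S. p w * V (F w y)) \<le> c * V y"
    and "0 < c"
  shows "AE s in M. \<exists>b. \<forall>k. V (traj F x k s) \<le> b * c ^ k"
proof -
  define B where "B N = {s \<in> space M. \<exists>k. real (Suc N) * c ^ k \<le> V (traj F x k s)}" for N
  have B: "B N \<in> events" for N unfolding B_def by measurable
  have bound: "prob (B N) \<le> V x / real (Suc N)" for N
  proof -
    define C where "C K = {s \<in> space M. \<exists>k\<le>K. real (Suc N) * c ^ k \<le> V (traj F x k s)}" for K
    have "C K \<in> events" for K unfolding C_def by measurable
    moreover have "incseq C" by (auto simp: incseq_def C_def intro: order_trans)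
    ultimately have "(\<lambda>K. prob (C K)) \<longlonglongrightarrow> prob (\<Union>K. C K)"
      by (intro finite_Lim_measure_incseq) auto
    moreover have "(\<Union>K. C K) = B N" by (auto simp: C_def B_def)
    moreover have "prob (C K) \<le> V x / real (Suc N)" for K
      unfolding C_def by (rule maximal_inequality[OF V drift \<open>0 < c\<close>]) auto
    ultimately show ?thesis by (auto intro: LIMSEQ_le_const2)
  qed
  have "prob (\<Inter>N. B N) \<le> V x / real (Suc N)" for N
    using B by (intro order_trans[OF finite_measure_mono bound[of N]]) auto
  moreover have "(\<lambda>N. V x / real (Suc N)) \<longlonglongrightarrow> 0"
    using lim_const_over_n[of "V x"] LIMSEQ_Suc by blast
  ultimately have "prob (\<Inter>N. B N) \<le> 0" by (intro LIMSEQ_le_const) auto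
  then have "prob (\<Inter>N. B N) = 0" by (simp add: measure_le_0_iff)
  then have "(\<Inter>N. B N) \<in> null_sets M"
    using B by (auto simp: null_sets_def emeasure_eq_measure)
  moreover have "{s \<in> space M. \<not> (\<exists>b. \<forall>k. V (traj F x k s) \<le> b * c ^ k)} \<subseteq> (\<Inter>N. B N)"
    by (auto simp: B_def not_le intro: less_imp_le)
  ultimately show ?thesis by (rule AE_I')
qed

end
section \<open>Extreme eigenvalues of symmetric matrices\<close>

lemma symmetric_matrix_inner:
  assumes "symmetric_matrix A"
  shows "x \<bullet> (A *v y) = y \<bullet> (A *v x)"
proof -
  have "x \<bullet> (A *v y) = (transpose A *v x) \<bullet> y"
    by (simp add: dot_lmul_matrix)
  also have "\<dots> = y \<bullet> (A *v x)"
    using assms by (simp only: symmetric_matrix_def inner_commute)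
  finally show ?thesis .
qed

text \<open>Otherwise the form would become negative at \<open>x + t A x\<close> for a small negative \<open>t\<close>.\<close>

lemma psd_null_vector:
  assumes sym: "symmetric_matrix A" and psd: "\<And>y. 0 \<le> y \<bullet> (A *v y)" and "x \<bullet> (A *v x) = 0"
  shows "A *v x = 0"
proof -
  define y where "y = A *v x"
  define c where "c = y \<bullet> (A *v y)"
  have q: "0 \<le> 2 * t * (y \<bullet> y) + t\<^sup>2 * c" for t
  proof -
    have "0 \<le> (x + t *\<^sub>R y) \<bullet> (A *v (x + t *\<^sub>R y))" by (rule psd)
    also have "\<dots> = 2 * t * (y \<bullet> y) + t\<^sup>2 * c"
      using assms(3) symmetric_matrix_inner[OF sym, of x y]
      by (simp add: algebra_simps inner_add_left inner_add_right y_def c_def power2_eq_square)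
    finally show ?thesis .
  qed
  have "y \<bullet> y = 0"
  proof (rule ccontr)
    assume "y \<bullet> y \<noteq> 0"
    then have "0 < y \<bullet> y" by (simp add: order_le_less)
    have c: "0 \<le> c" unfolding c_def by (rule psd)
    \<comment> \<open>Any negative \<open>t\<close> with \<open>\<bar>t\<bar> c < 2 (y \<bullet> y)\<close> works; the summand \<open>1\<close> covers \<open>c = 0\<close>.\<close>
    define t where "t = - ((y \<bullet> y) / (c + 1))"
    have "t < 0" using c \<open>0 < y \<bullet> y\<close> by (simp add: t_def)
    have "(y \<bullet> y) * (c / (c + 1)) \<le> (y \<bullet> y) * 1"
      using c by (intro mult_left_mono) auto
    moreover have "t * c = - ((y \<bullet> y) * (c / (c + 1)))" by (simp add: t_def)
    ultimately have "0 < 2 * (y \<bullet> y) + t * c"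
      using \<open>0 < y \<bullet> y\<close> by linarith
    then have "t * (2 * (y \<bullet> y) + t * c) < 0"
      using \<open>t < 0\<close> by (simp add: mult_less_0_iff)
    then show False using q[of t] by (simp add: algebra_simps power2_eq_square)
  qed
  then show ?thesis by (simp add: y_def)
qed

lemma eigenvaluesI: "x \<noteq> 0 \<Longrightarrow> A *v x = c *\<^sub>R x \<Longrightarrow> c \<in> eigenvalues A"
  by (auto simp: eigenvalues_def)

text \<open>Eigenvectors for distinct eigenvalues are orthogonal, hence independent. Finiteness is what gives
  \<open>Max\<close> and \<open>Min\<close> in \<open>cond_number\<close> their meaning.\<close>

lemma finite_eigenvalues:
  assumes "symmetric_matrix (A :: real^'n^'n)"
  shows "finite (eigenvalues A)"
proof -
  have "\<forall>c\<in>eigenvalues A. \<exists>x. x \<noteq> 0 \<and> A *v x = c *\<^sub>R x"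
    by (simp add: eigenvalues_def)
  then obtain v where "\<forall>c\<in>eigenvalues A. v c \<noteq> 0 \<and> A *v v c = c *\<^sub>R v c"
    by (rule bchoice[THEN exE])
  then have v: "v c \<noteq> 0" "A *v v c = c *\<^sub>R v c" if "c \<in> eigenvalues A" for c
    using that by auto
  have orth: "v c \<bullet> v d = 0" if "c \<in> eigenvalues A" "d \<in> eigenvalues A" "c \<noteq> d" for c d
    using symmetric_matrix_inner[OF assms, of "v c" "v d"] v(2)[OF that(1)] v(2)[OF that(2)] that(3)
    by (simp add: inner_commute)
  have "inj_on v (eigenvalues A)"
  proof (rule inj_onI, rule ccontr)
    fix c d assume cd: "c \<in> eigenvalues A" "d \<in> eigenvalues A" "v c = v d" "c \<noteq> d"
    then have "v c \<bullet> v c = 0" using orth[OF cd(1,2)] by simp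
    then show False using v(1)[OF cd(1)] by simp
  qed
  moreover have "independent (v ` eigenvalues A)"
    by (rule pairwise_orthogonal_independent)
       (use v orth in \<open>fastforce simp: pairwise_def orthogonal_def\<close>)+
  ultimately show ?thesis
    using independent_imp_finite finite_imageD by blast
qed

lemma symmetric_matrix_scale_minus:
  assumes "symmetric_matrix A"
  shows "symmetric_matrix (c *\<^sub>R mat 1 - A)"
  using assms by (auto simp: symmetric_matrix_def transpose_def vec_eq_iff mat_def)

text \<open>The maximum \<open>m\<close> of the form on the unit sphere is attained, and a maximizer is a null vector of
  the positive semidefinite matrix \<open>m I - A\<close>.\<close>

lemma max_rayleigh_eigenvalue:
  fixes A :: "real^'n^'n"
  assumes sym: "symmetric_matrix A"
  obtains m where "m \<in> eigenvalues A" "\<And>x. x \<bullet> (A *v x) \<le> m * (norm x)\<^sup>2"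
proof -
  have "compact (sphere (0::real^'n) 1)" by simp
  moreover have "sphere (0::real^'n) 1 \<noteq> {}" by simp
  moreover have "continuous_on (sphere 0 1) (\<lambda>x. x \<bullet> (A *v x))"
    by (intro continuous_intros matrix_vector_mult_linear_continuous_on)
  ultimately obtain x0 where x0: "norm x0 = 1" and
    max: "\<And>x. norm x = 1 \<Longrightarrow> x \<bullet> (A *v x) \<le> x0 \<bullet> (A *v x0)"
    by (metis (no_types, lifting) continuous_attains_sup mem_sphere_0)
  define m where "m = x0 \<bullet> (A *v x0)"
  have le: "x \<bullet> (A *v x) \<le> m * (norm x)\<^sup>2" for x
  proof (cases "x = 0")
    case False
    define y where "y = (1 / norm x) *\<^sub>R x"
    have "x \<bullet> (A *v x) = (norm x)\<^sup>2 * (y \<bullet> (A *v y))"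
      using False by (simp add: y_def algebra_simps power2_eq_square)
    also have "\<dots> \<le> (norm x)\<^sup>2 * m"
      unfolding m_def using False by (intro mult_left_mono max) (auto simp: y_def)
    finally show ?thesis by (simp add: mult.commute)
  qed simp
  have "(m *\<^sub>R mat 1 - A) *v x0 = 0"
    by (rule psd_null_vector[OF symmetric_matrix_scale_minus[OF sym]])
       (use le x0 in \<open>auto simp: algebra_simps inner_diff_right m_def power2_norm_eq_inner
          simp flip: scaleR_matrix_vector_assoc\<close>, simp add: norm_eq_1)
  then have "m \<in> eigenvalues A"
    using x0 by (intro eigenvaluesI[of x0]) (auto simp: algebra_simps simp flip: scaleR_matrix_vector_assoc)
  then show ?thesis using le that by blast
qed

lemma rayleigh_le_Max_eigenvalue:
  assumes "symmetric_matrix (A :: real^'n^'n)"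
  shows "x \<bullet> (A *v x) \<le> Max (eigenvalues A) * (norm x)\<^sup>2"
proof -
  obtain m where m: "m \<in> eigenvalues A" "\<And>x. x \<bullet> (A *v x) \<le> m * (norm x)\<^sup>2"
    using max_rayleigh_eigenvalue[OF assms] by blast
  have "x \<bullet> (A *v x) \<le> m * (norm x)\<^sup>2" by (rule m)
  also have "\<dots> \<le> Max (eigenvalues A) * (norm x)\<^sup>2"
    by (intro mult_right_mono Max_ge finite_eigenvalues assms m(1)) auto
  finally show ?thesis .
qed

lemma Min_eigenvalue_le_rayleigh:
  assumes "symmetric_matrix (A :: real^'n^'n)"
  shows "Min (eigenvalues A) * (norm x)\<^sup>2 \<le> x \<bullet> (A *v x)"
proof -
  have "symmetric_matrix (- A)"
    using symmetric_matrix_scale_minus[OF assms, of 0] by simp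
  then obtain m where m: "m \<in> eigenvalues (- A)" "\<And>x. x \<bullet> ((- A) *v x) \<le> m * (norm x)\<^sup>2"
    using max_rayleigh_eigenvalue by blast
  have "(- A) *v x = - (A *v x)" for x
    using matrix_vector_mult_diff_rdistrib[of 0 A x] by simp
  then obtain e where "e \<noteq> 0" "- (A *v e) = m *\<^sub>R e"
    using m(1) by (auto simp: eigenvalues_def)
  then have "- m \<in> eigenvalues A"
    by (intro eigenvaluesI[of e]) (simp_all add: minus_equation_iff[of _ "m *\<^sub>R e"] flip: \<open>- (A *v e) = m *\<^sub>R e\<close>)
  then have "Min (eigenvalues A) * (norm x)\<^sup>2 \<le> (- m) * (norm x)\<^sup>2"
    by (intro mult_right_mono Min_le finite_eigenvalues assms) auto
  also have "\<dots> \<le> x \<bullet> (A *v x)"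
    using m(2)[of x] matrix_vector_mult_diff_rdistrib[of 0 A x] by simp
  finally show ?thesis .
qed

lemma Min_eigenvalue_pos:
  assumes "pos_def (A :: real^'n^'n)"
  shows "0 < Min (eigenvalues A)"
proof -
  have sym: "symmetric_matrix A" using assms by (simp add: pos_def_def)
  have "eigenvalues A \<noteq> {}" using max_rayleigh_eigenvalue[OF sym] by blast
  moreover have "0 < c" if c: "c \<in> eigenvalues A" for c
  proof -
    obtain x where x: "x \<noteq> 0" "A *v x = c *\<^sub>R x" using c by (auto simp: eigenvalues_def)
    then have "0 < c * (x \<bullet> x)" using assms unfolding pos_def_def by (metis inner_scaleR_right)
    then show ?thesis using inner_ge_zero[of x] by (auto simp: zero_less_mult_iff)
  qed
  ultimately show ?thesis by (simp add: finite_eigenvalues sym)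
qed

section \<open>Block matrices\<close>

lemma sum_UNIV_sum_type:
  fixes g :: "'a::finite + 'b::finite \<Rightarrow> 'c::comm_monoid_add"
  shows "(\<Sum>s\<in>UNIV. g s) = (\<Sum>a\<in>UNIV. g (Inl a)) + (\<Sum>b\<in>UNIV. g (Inr b))"
  by (subst UNIV_Plus_UNIV[symmetric], subst sum.Plus) auto

lemma hcat_mult_vcat: "hcat A B *v vcat x y = A *v x + B *v y"
  by (simp add: vec_eq_iff matrix_vector_mult_def hcat_def vcat_def sum_UNIV_sum_type)

lemma vcat_mult: "vcat A B *v x = vcat (A *v x) (B *v x)"
  by (simp add: vec_eq_iff matrix_vector_mult_def vcat_def split: sum.split)

lemma vcat2_mult: "vcat2 A B *v x = vcat2 (A *v x) (B *v x)"
  by (simp add: vec_eq_iff matrix_vector_mult_def vcat2_def)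

lemma inner_vcat: "vcat x y \<bullet> vcat x' y' = x \<bullet> x' + y \<bullet> (y' :: real^_)"
  by (simp add: inner_vec_def vcat_def sum_UNIV_sum_type)

lemma vcat_add: "vcat x y + vcat x' y' = vcat (x + x') (y + y')"
  by (auto simp: vcat_def vec_eq_iff split: sum.split)

lemma block_diag_mult_vcat: "block_diag A B *v vcat x y = vcat (A *v x) (B *v y)"
  by (simp add: block_diag_def vcat_mult hcat_mult_vcat)

text \<open>This is what links the last diagonal block of the matrix inequality to the sector conditions of the
  individual agents: it makes the block nonnegative along the dynamics.\<close>

lemma kron_M0_form:
  "vcat2 x u \<bullet> (kron (M0 \<mu> l) (mat 1) *v vcat2 x u)
    = (\<Sum>i\<in>UNIV. - 2 * \<mu> * l * (x $ i)\<^sup>2 + 2 * (l + \<mu>) * (x $ i) * (u $ i) - 2 * (u $ i)\<^sup>2)"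
proof -
  have pair: "(\<Sum>r\<in>UNIV. g r) = (\<Sum>i\<in>UNIV. g (1, i) + g (2, i))"
    for g :: "2 \<times> 'n::finite \<Rightarrow> real"
  proof -
    have "(\<Sum>r\<in>UNIV. g r) = (\<Sum>a\<in>UNIV. \<Sum>i\<in>UNIV. g (a, i))"
      by (simp add: sum.cartesian_product)
    then show ?thesis by (simp add: sum_2 sum.distrib)
  qed
  have neq: "(1::2) \<noteq> 2" "(2::2) \<noteq> 1" by auto
  have row: "(kron (M0 \<mu> l) (mat 1) *v vcat2 x u) $ (a, i)
      = M0 \<mu> l $ a $ 1 * x $ i + M0 \<mu> l $ a $ 2 * u $ i" for a i
    by (simp add: matrix_vector_mult_def kron_def pair vcat2_def mat_def sum.distrib
        if_distrib[of "\<lambda>t. _ * t"] if_distrib[of "\<lambda>t. t * _"] neq cong: if_cong)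
  show ?thesis
    unfolding inner_vec_def pair
    by (intro sum.cong refl)
       (simp add: row, simp add: vcat2_def M0_def neq algebra_simps power2_eq_square)
qed

lemma quadratic_congruence:
  "y \<bullet> ((transpose B ** A ** B) *v y) = (B *v y) \<bullet> (A *v (B *v y))" for A :: "real^'m^'m"
  by (simp only: matrix_vector_mul_assoc[symmetric] dot_lmul_matrix[symmetric] vector_transpose_matrix)

lemma sum_matrix_vector_mult: "(\<Sum>w\<in>S. A w) *v y = (\<Sum>w\<in>S. A w *v y)" for A :: "_ \<Rightarrow> real^'n^'m"
  by (induction S rule: infinite_finite_induct) (auto simp: matrix_vector_mult_add_rdistrib)

lemma restrict_rows_mult: "restrict_rows idx A *v x = restrict_vec idx (A *v x)"
  by (simp add: restrict_rows_def restrict_vec_def matrix_vector_mult_def)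

text \<open>Dropping coordinates of the columns is harmless for vectors that vanish on these coordinates.\<close>

lemma restrict_cols_mult:
  assumes "inj idx" and "\<And>c. c \<notin> range idx \<Longrightarrow> y $ c = 0"
  shows "restrict_cols idx A *v restrict_vec idx y = A *v y"
proof -
  have "(\<Sum>s\<in>UNIV. A $ r $ idx s * y $ idx s) = (\<Sum>c\<in>UNIV. A $ r $ c * y $ c)" for r
  proof -
    have "(\<Sum>s\<in>UNIV. A $ r $ idx s * y $ idx s) = (\<Sum>c\<in>range idx. A $ r $ c * y $ c)"
      using assms(1) by (simp add: sum.reindex)
    also have "\<dots> = (\<Sum>c\<in>UNIV. A $ r $ c * y $ c)"
      by (rule sum.mono_neutral_left) (auto simp: assms(2))
    finally show ?thesis .
  qed
  then show ?thesis
    by (simp add: restrict_cols_def restrict_vec_def matrix_vector_mult_def)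
qed

lemma numbering_range: "state_numbering E idx \<Longrightarrow> range idx = UNIV <+> (UNIV <+> E)"
  by (simp add: state_numbering_def bij_betw_def)

lemma numbering_inj: "state_numbering E idx \<Longrightarrow> inj idx"
  by (simp add: state_numbering_def bij_betw_def)

section \<open>The model as a linear system with input\<close>

text \<open>The update with an arbitrary input \<open>u\<close> in place of the gradient. It is jointly linear in \<open>u\<close> and
  the state, which makes differences of trajectories accessible to the matrix inequality.\<close>

definition lin_step ::
  "('n::finite \<times> 'n) set \<Rightarrow> real^'n^'n \<Rightarrow> real \<Rightarrow> real \<Rightarrow> real \<Rightarrow> real \<Rightarrow>
   ('n \<times> 'n) set \<Rightarrow> real^'n \<Rightarrow> 'n pe_state \<Rightarrow> 'n pe_state"
where
  "lin_step E L \<alpha> \<delta> \<zeta> \<eta> w u st =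
     (let v = pe_v E L \<delta> \<eta> st;
          w1' = fst st - \<zeta> *\<^sub>R v - \<alpha> *\<^sub>R u;
          w2' = (mat 1 - avg) *v (fst st + fst (snd st) - v)
      in (w1', w2', \<chi> t. if t \<in> w then \<delta> * w1' $ snd t + \<eta> * w2' $ snd t
            else snd (snd st) $ t + \<eta> * ((mat 1 - avg) *v (fst st - v)) $ fst t))"

definition pe_x :: "('n::finite \<times> 'n) set \<Rightarrow> real^'n^'n \<Rightarrow> real \<Rightarrow> real \<Rightarrow> 'n pe_state \<Rightarrow> real^'n" where
  "pe_x E L \<delta> \<eta> st = fst st - pe_v E L \<delta> \<eta> st"

lemma pe_step_eq_lin_step:
  "pe_step E L f \<alpha> \<delta> \<zeta> \<eta> w st = lin_step E L \<alpha> \<delta> \<zeta> \<eta> w (gradF f (pe_x E L \<delta> \<eta> st)) st"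
  by (cases st) (auto simp: lin_step_def pe_x_def Let_def vec_eq_iff)

lemma pe_v_diff: "pe_v E L \<delta> \<eta> (st - st') = pe_v E L \<delta> \<eta> st - pe_v E L \<delta> \<eta> st'"
  by (cases st; cases st') (simp add: algebra_simps)

lemma pe_x_diff: "pe_x E L \<delta> \<eta> (st - st') = pe_x E L \<delta> \<eta> st - pe_x E L \<delta> \<eta> st'"
  by (simp add: pe_x_def pe_v_diff algebra_simps)

lemma lin_step_diff:
  "lin_step E L \<alpha> \<delta> \<zeta> \<eta> w (u - u') (st - st')
    = lin_step E L \<alpha> \<delta> \<zeta> \<eta> w u st - lin_step E L \<alpha> \<delta> \<zeta> \<eta> w u' st'"
  by (auto simp: lin_step_def Let_def pe_v_diff algebra_simps vec_eq_iff prod_eq_iff)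

lemma stack_diff: "stack idx (st - st') = stack idx st - stack idx st'"
  by (cases st; cases st') (auto simp: restrict_vec_def vcat_def vec_eq_iff split: sum.split)

text \<open>The edge coordinates outside \<open>E\<close> carry no information. Equality up to these coordinates is
  respected by the dynamics and invisible in the output and in the stacked state.\<close>

definition pe_eq :: "('n::finite \<times> 'n) set \<Rightarrow> 'n pe_state \<Rightarrow> 'n pe_state \<Rightarrow> bool" where
  "pe_eq E st st' \<longleftrightarrow> fst st = fst st' \<and> fst (snd st) = fst (snd st')
     \<and> (\<forall>t\<in>E. snd (snd st) $ t = snd (snd st') $ t)"

lemma pe_eq_v:
  assumes "pe_eq E st st'"
  shows "pe_v E L \<delta> \<eta> st = pe_v E L \<delta> \<eta> st'"
proof -
  have "Ebar E L *v snd (snd st) = Ebar E L *v snd (snd st')"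
    using assms by (auto simp: pe_eq_def Ebar_def matrix_vector_mult_def vec_eq_iff intro!: sum.cong)
  then show ?thesis using assms by (cases st; cases st') (simp add: pe_eq_def)
qed

lemma pe_eq_x: "pe_eq E st st' \<Longrightarrow> pe_x E L \<delta> \<eta> st = pe_x E L \<delta> \<eta> st'"
  by (simp add: pe_x_def pe_eq_v) (simp add: pe_eq_def)

lemma pe_eq_lin_step:
  assumes "pe_eq E st st'"
  shows "pe_eq E (lin_step E L \<alpha> \<delta> \<zeta> \<eta> w u st) (lin_step E L \<alpha> \<delta> \<zeta> \<eta> w u st')"
  unfolding lin_step_def pe_eq_v[OF assms] using assms by (auto simp: pe_eq_def Let_def)

lemma pe_eq_stack:
  assumes "state_numbering E idx" and "pe_eq E st st'"
  shows "stack idx st = stack idx st'"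
proof -
  obtain w1 w2 \<phi> \<phi>' where st: "st = (w1, w2, \<phi>)" "st' = (w1, w2, \<phi>')"
    using assms(2) by (cases st; cases st') (auto simp: pe_eq_def)
  have "vcat w1 (vcat w2 \<phi>) $ idx s = vcat w1 (vcat w2 \<phi>') $ idx s" for s
  proof -
    have "idx s \<in> UNIV <+> (UNIV <+> E)"
      using numbering_range[OF assms(1)] by blast
    then show ?thesis
      using assms(2) st by (auto simp: vcat_def pe_eq_def)
  qed
  then show ?thesis by (simp add: st restrict_vec_def)
qed

lemma stack_eq_0D:
  assumes "state_numbering E idx" "stack idx (w1, w2, \<phi>) = 0"
  shows "w1 = 0" "w2 = 0"
proof -
  have *: "vcat w1 (vcat w2 \<phi>) $ c = 0" if "c \<in> UNIV <+> (UNIV <+> E)" for c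
    using that assms(2) numbering_range[OF assms(1), symmetric]
    by (auto simp: restrict_vec_def vec_eq_iff)
  show "w1 = 0" using *[of "Inl _"] by (auto simp: vec_eq_iff vcat_def)
  show "w2 = 0" using *[of "Inr (Inl _)"] by (auto simp: vec_eq_iff vcat_def)
qed

lemma inner_row: "row i A \<bullet> x = (A *v x) $ i" for A :: "real^'m^'n"
  by (simp add: row_def inner_vec_def matrix_vector_mult_def)

lemma uminus_matrix_mult: "(- A) *v x = - (A *v x)" for A :: "real^'m^'n"
  using matrix_vector_mult_diff_rdistrib[of 0 A x] by simp

lemma A1_mult:
  "A1 E L \<delta> \<zeta> \<eta> *v vcat w1 (vcat w2 \<phi>) = w1 - \<zeta> *\<^sub>R pe_v E L \<delta> \<eta> (w1, w2, \<phi>)"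
  by (simp add: A1_def hcat_mult_vcat algebra_simps uminus_matrix_mult flip: scaleR_matrix_vector_assoc)

lemma C_mult:
  "hcat (mat 1 - \<delta> *\<^sub>R diag_part L) (hcat (- \<eta> *\<^sub>R diag_part L) (- Ebar E L)) *v vcat w1 (vcat w2 \<phi>)
    = w1 - pe_v E L \<delta> \<eta> (w1, w2, \<phi>)"
  by (simp add: hcat_mult_vcat algebra_simps uminus_matrix_mult flip: scaleR_matrix_vector_assoc)

lemma A2_mult:
  "A2 E L \<delta> \<eta> *v vcat w1 (vcat w2 \<phi>) = (mat 1 - avg) *v (w1 + w2 - pe_v E L \<delta> \<eta> (w1, w2, \<phi>))"
  unfolding A2_def matrix_vector_mul_assoc[symmetric] hcat_mult_vcat
  by (rule arg_cong[where f = "(*v) (mat 1 - avg)"])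
     (simp add: algebra_simps uminus_matrix_mult flip: scaleR_matrix_vector_assoc)

lemma matrix_mult_nth: "(A *v x) $ i = A $ i \<bullet> x" for A :: "real^'m^'n"
  by (simp add: inner_vec_def matrix_vector_mult_def)

lemma A_phi_mult:
  "A_phi E L \<delta> \<zeta> \<eta> w *v vcat w1 (vcat w2 \<phi>) + B_phi \<alpha> \<delta> w *v u
    = snd (snd (lin_step E L \<alpha> \<delta> \<zeta> \<eta> w u (w1, w2, \<phi>)))"
proof -
  let ?Q = "mat 1 - avg :: real^'n^'n"
  have "(A_phi E L \<delta> \<zeta> \<eta> w *v vcat w1 (vcat w2 \<phi>) + B_phi \<alpha> \<delta> w *v u) $ (i, j)
    = snd (snd (lin_step E L \<alpha> \<delta> \<zeta> \<eta> w u (w1, w2, \<phi>))) $ (i, j)" for i j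
  proof (cases "(i, j) \<in> w")
    case True
    then show ?thesis
      by (simp add: matrix_mult_nth A_phi_def B_phi_def inner_vcat inner_row inner_axis'
          lin_step_def Let_def)
         (simp add: matrix_mult_nth[symmetric] algebra_simps uminus_matrix_mult
           flip: scaleR_matrix_vector_assoc matrix_vector_mul_assoc)
  next
    case False
    then show ?thesis
      by (simp add: matrix_mult_nth A_phi_def B_phi_def inner_vcat inner_row inner_axis' inner_diff_left
          lin_step_def Let_def)
         (simp add: matrix_mult_nth[symmetric] algebra_simps uminus_matrix_mult power2_eq_square
           flip: scaleR_matrix_vector_assoc matrix_vector_mul_assoc)
  qed
  then show ?thesis by (simp add: vec_eq_iff split_paired_all)
qed

text \<open>The matrices of the linear matrix inequality are those of the model. Here the junk coordinates
  are set to zero, since the restricted columns cannot see them.\<close>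

lemma system_matrices_mult_stack_zero_outside:
  assumes "state_numbering E idx" "\<And>t. t \<notin> E \<Longrightarrow> \<phi> $ t = 0"
  shows "A_mat idx E L \<delta> \<zeta> \<eta> w *v stack idx (w1, w2, \<phi>) + B_mat idx \<alpha> \<delta> w *v u
      = stack idx (lin_step E L \<alpha> \<delta> \<zeta> \<eta> w u (w1, w2, \<phi>))"
    and "C_mat idx E L \<delta> \<eta> *v stack idx (w1, w2, \<phi>) = pe_x E L \<delta> \<eta> (w1, w2, \<phi>)"
proof -
  have junk: "vcat w1 (vcat w2 \<phi>) $ c = 0" if "c \<notin> range idx" for c
    using that assms(2) unfolding numbering_range[OF assms(1)]
    by (auto simp: vcat_def split: sum.split)
  have restrict: "restrict_vec idx x + restrict_vec idx y = restrict_vec idx (x + y)" for x y :: "real^'c"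
    and idx :: "'d::finite \<Rightarrow> 'c"
    by (simp add: restrict_vec_def vec_eq_iff)
  note cols = restrict_cols_mult[OF numbering_inj[OF assms(1)] junk]
  show "C_mat idx E L \<delta> \<eta> *v stack idx (w1, w2, \<phi>) = pe_x E L \<delta> \<eta> (w1, w2, \<phi>)"
    unfolding C_mat_def stack.simps pe_x_def fst_conv
    by (subst cols) (simp_all only: C_mult not_False_eq_True)
  show "A_mat idx E L \<delta> \<zeta> \<eta> w *v stack idx (w1, w2, \<phi>) + B_mat idx \<alpha> \<delta> w *v u
      = stack idx (lin_step E L \<alpha> \<delta> \<zeta> \<eta> w u (w1, w2, \<phi>))"
    by (simp add: A_mat_def B_mat_def restrict_rows_mult cols restrict vcat_mult vcat_add
        A_phi_mult A1_mult A2_mult uminus_matrix_mult del: pe_v.simps flip: scaleR_matrix_vector_assoc)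
       (simp add: lin_step_def Let_def)
qed

lemma system_matrices_mult_stack:
  assumes "state_numbering E idx"
  shows "A_mat idx E L \<delta> \<zeta> \<eta> w *v stack idx st + B_mat idx \<alpha> \<delta> w *v u
      = stack idx (lin_step E L \<alpha> \<delta> \<zeta> \<eta> w u st)"
    and "C_mat idx E L \<delta> \<eta> *v stack idx st = pe_x E L \<delta> \<eta> st"
proof -
  define st' where "st' = (fst st, fst (snd st), (\<chi> t. if t \<in> E then snd (snd st) $ t else 0) :: real^_)"
  have eq: "pe_eq E st' st" by (auto simp: st'_def pe_eq_def)
  note stack = pe_eq_stack[OF assms eq]
  have "stack idx (lin_step E L \<alpha> \<delta> \<zeta> \<eta> w u st') = stack idx (lin_step E L \<alpha> \<delta> \<zeta> \<eta> w u st)"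
    by (rule pe_eq_stack[OF assms pe_eq_lin_step[OF eq]])
  moreover have "A_mat idx E L \<delta> \<zeta> \<eta> w *v stack idx st' + B_mat idx \<alpha> \<delta> w *v u
      = stack idx (lin_step E L \<alpha> \<delta> \<zeta> \<eta> w u st')"
    unfolding st'_def by (rule system_matrices_mult_stack_zero_outside(1)[OF assms]) auto
  ultimately show "A_mat idx E L \<delta> \<zeta> \<eta> w *v stack idx st + B_mat idx \<alpha> \<delta> w *v u
      = stack idx (lin_step E L \<alpha> \<delta> \<zeta> \<eta> w u st)"
    by (simp add: stack)
  have "C_mat idx E L \<delta> \<eta> *v stack idx st' = pe_x E L \<delta> \<eta> st'"
    unfolding st'_def by (rule system_matrices_mult_stack_zero_outside(2)[OF assms]) auto
  then show "C_mat idx E L \<delta> \<eta> *v stack idx st = pe_x E L \<delta> \<eta> st"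
    by (simp add: stack pe_eq_x[OF eq])
qed

text \<open>The three row blocks of the outer factor map the stacked state and input to the next state, the
  state, and the pair of output and input. So the congruence evaluates the three diagonal blocks of
  the inner factor at these vectors.\<close>

lemma lmi_dissipation:
  assumes num: "state_numbering E idx"
    and lmi: "neg_semidef (lmi_matrix idx E L pl \<mu> l \<alpha> \<delta> \<zeta> \<eta> \<rho> lam0 P)"
  defines "Q \<equiv> \<lambda>\<xi>. \<xi> \<bullet> (P *v \<xi>)"
  shows "(\<Sum>w\<in>Pow E. loss_prob E pl w *
      (Q (stack idx (lin_step E L \<alpha> \<delta> \<zeta> \<eta> w u st)) - \<rho>\<^sup>2 * Q (stack idx st)
       + lam0 * (\<Sum>i\<in>UNIV. - 2 * \<mu> * l * (pe_x E L \<delta> \<eta> st $ i)\<^sup>2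
           + 2 * (l + \<mu>) * (pe_x E L \<delta> \<eta> st $ i) * (u $ i) - 2 * (u $ i)\<^sup>2))) \<le> 0"
proof -
  define y where "y = vcat (stack idx st) u"
  let ?O = "lmi_outer idx E L \<alpha> \<delta> \<zeta> \<eta>"
  have outer: "?O w *v y = vcat (stack idx (lin_step E L \<alpha> \<delta> \<zeta> \<eta> w u st))
      (vcat (stack idx st) (vcat2 (pe_x E L \<delta> \<eta> st) u))" for w
    by (simp add: lmi_outer_def y_def vcat_mult vcat2_mult hcat_mult_vcat system_matrices_mult_stack[OF num])
  have form: "(?O w *v y) \<bullet> (lmi_inner \<mu> l \<rho> lam0 P *v (?O w *v y))
    = Q (stack idx (lin_step E L \<alpha> \<delta> \<zeta> \<eta> w u st)) - \<rho>\<^sup>2 * Q (stack idx st)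
       + lam0 * (\<Sum>i\<in>UNIV. - 2 * \<mu> * l * (pe_x E L \<delta> \<eta> st $ i)\<^sup>2
           + 2 * (l + \<mu>) * (pe_x E L \<delta> \<eta> st $ i) * (u $ i) - 2 * (u $ i)\<^sup>2)" for w
    unfolding outer lmi_inner_def block_diag_mult_vcat inner_vcat kron_M0_form[symmetric]
    by (simp add: Q_def uminus_matrix_mult flip: scaleR_matrix_vector_assoc)
  have "y \<bullet> (lmi_matrix idx E L pl \<mu> l \<alpha> \<delta> \<zeta> \<eta> \<rho> lam0 P *v y) \<le> 0"
    using lmi by (simp add: neg_semidef_def)
  then show ?thesis
    unfolding lmi_matrix_def sum_matrix_vector_mult scaleR_matrix_vector_assoc[symmetric]
      inner_sum_right inner_scaleR_right quadratic_congruence form .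
qed

section \<open>Laplacian and equilibria\<close>

lemma avg_mult: "avg *v x = vec ((\<Sum>i\<in>UNIV. x $ i) / CARD('n))" for x :: "real^'n"
  by (simp add: avg_def matrix_vector_mult_def vec_eq_iff sum_divide_distrib)

lemma center_vec: "(mat 1 - avg) *v vec c = (0 :: real^'n)"
  by (simp add: matrix_vector_mult_diff_rdistrib avg_mult)

lemma center_balanced:
  "(\<Sum>i\<in>UNIV. x $ i) = 0 \<Longrightarrow> (mat 1 - avg) *v x = x" for x :: "real^'n"
  by (simp add: matrix_vector_mult_diff_rdistrib avg_mult vec_eq_iff)

lemma laplacian_offdiag: "i \<noteq> j \<Longrightarrow> (i, j) \<notin> E \<Longrightarrow> laplacian E a $ i $ j = 0"
  by (simp add: laplacian_def)

lemma laplacian_row_sum: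
  assumes "\<And>i. (i, i) \<notin> E"
  shows "laplacian E a $ i $ i + (\<Sum>j | (i, j) \<in> E. laplacian E a $ i $ j) = 0"
proof -
  have "(\<Sum>j | (i, j) \<in> E. laplacian E a $ i $ j) = (\<Sum>j | (i, j) \<in> E. - a i j)"
    using assms by (intro sum.cong) (auto simp: laplacian_def)
  then show ?thesis by (simp add: laplacian_def sum_negf)
qed

lemma Ebar_mult: "(Ebar E L *v \<phi>) $ i = (\<Sum>j | (i, j) \<in> E. L $ i $ j * \<phi> $ (i, j))"
proof -
  have "(Ebar E L *v \<phi>) $ i
      = (\<Sum>t\<in>UNIV. if t \<in> E \<and> fst t = i then L $ i $ snd t * \<phi> $ t else 0)"
    by (auto simp: Ebar_def matrix_vector_mult_def intro!: sum.cong)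
  also have "\<dots> = (\<Sum>t | t \<in> E \<and> fst t = i. L $ i $ snd t * \<phi> $ t)"
    by (simp add: sum.If_cases)
  also have "\<dots> = (\<Sum>j | (i, j) \<in> E. L $ i $ j * \<phi> $ (i, j))"
    by (rule sum.reindex_bij_witness[of _ "\<lambda>j. (i, j)" snd]) auto
  finally show ?thesis .
qed

lemma laplacian_mult:
  assumes "\<And>i. (i, i) \<notin> E"
  shows "(laplacian E a *v x) $ i
    = laplacian E a $ i $ i * x $ i + (\<Sum>j | (i, j) \<in> E. laplacian E a $ i $ j * x $ j)"
proof -
  have "(laplacian E a *v x) $ i = (\<Sum>j\<in>insert i {j. (i, j) \<in> E}. laplacian E a $ i $ j * x $ j)"
    unfolding matrix_vector_mult_def
    by (simp, rule sum.mono_neutral_right) (auto simp: laplacian_offdiag)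
  then show ?thesis using assms by simp
qed

lemma diag_part_mult: "(diag_part A *v x) $ i = A $ i $ i * x $ i"
  by (simp add: diag_part_def matrix_vector_mult_def if_distrib[of "\<lambda>t. t * _"] cong: if_cong)

text \<open>The memories after a successful transmission over every edge.\<close>

definition edge_mem :: "real \<Rightarrow> real \<Rightarrow> real^'n \<Rightarrow> real^'n \<Rightarrow> real^('n::finite \<times> 'n)" where
  "edge_mem \<delta> \<eta> w1 w2 = (\<chi> t. \<delta> * w1 $ snd t + \<eta> * w2 $ snd t)"

text \<open>With such memories, the lossy exchange computes exactly the product with the Laplacian.\<close>

lemma pe_v_edge_mem:
  assumes "\<And>i. (i, i) \<notin> E"
  shows "pe_v E (laplacian E a) \<delta> \<eta> (w1, w2, edge_mem \<delta> \<eta> w1 w2)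
    = laplacian E a *v (\<delta> *\<^sub>R w1 + \<eta> *\<^sub>R w2)"
  by (simp add: vec_eq_iff laplacian_mult[OF assms] Ebar_mult diag_part_mult edge_mem_def)

lemma lin_step_equilibrium:
  fixes E :: "('n::finite \<times> 'n) set" and a w1 w2 u and \<alpha> \<delta> \<zeta> \<eta> :: real
  assumes "\<And>i. (i, i) \<notin> E"
  defines "v \<equiv> laplacian E a *v (\<delta> *\<^sub>R w1 + \<eta> *\<^sub>R w2)"
  assumes "\<zeta> *\<^sub>R v + \<alpha> *\<^sub>R u = 0" "(mat 1 - avg) *v (w1 + w2 - v) = w2"
    "(mat 1 - avg) *v (w1 - v) = 0"
  shows "lin_step E (laplacian E a) \<alpha> \<delta> \<zeta> \<eta> w u (w1, w2, edge_mem \<delta> \<eta> w1 w2)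
    = (w1, w2, edge_mem \<delta> \<eta> w1 w2)"
proof -
  have "pe_v E (laplacian E a) \<delta> \<eta> (w1, w2, edge_mem \<delta> \<eta> w1 w2) = v"
    unfolding v_def by (rule pe_v_edge_mem) (rule assms(1))
  moreover have "w1 - \<zeta> *\<^sub>R v - \<alpha> *\<^sub>R u = w1"
    using assms(3) by (simp add: diff_diff_eq)
  ultimately show ?thesis
    using assms(4,5)
    by (simp add: lin_step_def Let_def del: pe_v.simps) (simp add: edge_mem_def vec_eq_iff)
qed

text \<open>The bound on \<open>I - \<Pi> - L\<close> makes \<open>L + \<Pi>\<close> injective, hence surjective. A solution of
  \<open>(L + \<Pi>) z = y\<close> has the same entry sum as \<open>y\<close>, because \<open>L\<close> has zero column sums; so \<open>\<Pi> z = 0\<close> if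
  \<open>y\<close> sums to zero.\<close>

lemma balanced_solution:
  fixes L :: "real^'n^'n"
  assumes balanced: "(1 :: real^'n) v* L = 0"
    and sigma: "spectral_norm (mat 1 - avg - L) < 1"
    and y: "(\<Sum>i\<in>UNIV. y $ i) = 0"
  obtains z where "L *v z = y" "(\<Sum>i\<in>UNIV. z $ i) = 0"
proof -
  have total: "(\<Sum>i\<in>UNIV. (L *v x) $ i) = 0" for x
    using dot_lmul_matrix[of 1 L x] balanced by (simp add: inner_vec_def)
  have "x = 0" if "(L + avg) *v x = 0" for x
  proof -
    have "x = (mat 1 - avg - L) *v x"
      using that by (simp add: algebra_simps)
    then have "norm x \<le> spectral_norm (mat 1 - avg - L) * norm x"
      unfolding spectral_norm_def
      by (metis onorm matrix_vector_mul_bounded_linear)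
    then have "(1 - spectral_norm (mat 1 - avg - L)) * norm x \<le> 0" by (simp add: algebra_simps)
    then show "x = 0" using sigma by (simp add: mult_le_0_iff)
  qed
  then have "inj ((*v) (L + avg))"
    by (simp add: linear_injective_0)
  then have "surj ((*v) (L + avg))"
    by (intro linear_injective_imp_surjective) auto
  then obtain z where z: "y = (L + avg) *v z" by (metis surjD)
  have "(\<Sum>i\<in>UNIV. y $ i) = (\<Sum>i\<in>UNIV. z $ i)"
    unfolding z matrix_vector_mult_add_rdistrib avg_mult by (simp add: sum.distrib total)
  then have z0: "(\<Sum>i\<in>UNIV. z $ i) = 0" using y by simp
  then have "L *v z = y"
    unfolding z matrix_vector_mult_add_rdistrib avg_mult by (simp add: vec_eq_iff)
  then show ?thesis using z0 that by blast
qed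

text \<open>The assumption \<open>isolated\<close> is what the matrix inequality contributes: the system without input has
  no nonzero invariant state with output \<open>0\<close>. For \<open>u \<noteq> 0\<close>, the vector \<open>u\<close> itself would provide such a
  state: \<open>(0, u)\<close> if \<open>\<eta> = 0\<close>, since \<open>w\<^sub>2\<close> then has no influence, and \<open>(u, z)\<close> with
  \<open>\<eta> L z = u - \<delta> L u\<close> if \<open>\<zeta> = 0\<close>, since \<open>w\<^sub>1\<close> is then not corrected by \<open>v\<close>. In the remaining case the
  multiple of \<open>(u, z)\<close> by \<open>- \<alpha> / \<zeta>\<close> is the desired equilibrium.\<close>

lemma equilibrium_exists:
  fixes L :: "real^'n^'n" and E :: "('n \<times> 'n) set"
  assumes no_loops: "\<And>i. (i, i) \<notin> E" and L_def: "L = laplacian E a"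
    and balanced: "(1 :: real^'n) v* L = 0"
    and sigma: "spectral_norm (mat 1 - avg - L) < 1"
    and u: "(\<Sum>i\<in>UNIV. u $ i) = 0"
    and isolated: "\<And>w1 w2 \<phi>. (\<And>w. lin_step E L \<alpha> \<delta> \<zeta> \<eta> w 0 (w1, w2, \<phi>) = (w1, w2, \<phi>)) \<Longrightarrow>
        pe_x E L \<delta> \<eta> (w1, w2, \<phi>) = 0 \<Longrightarrow> w1 = 0 \<and> w2 = 0"
  obtains v w2 where "(\<Sum>i\<in>UNIV. v $ i) = 0" "(\<Sum>i\<in>UNIV. w2 $ i) = 0"
    "L *v (\<delta> *\<^sub>R v + \<eta> *\<^sub>R w2) = v" "\<zeta> *\<^sub>R v + \<alpha> *\<^sub>R u = 0"
proof (cases "u = 0")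
  case True
  then show ?thesis by (intro that[of 0 0]) auto
next
  case False
  note v_edge = pe_v_edge_mem[OF no_loops, of a, folded L_def]
  note equil = lin_step_equilibrium[OF no_loops, where a = a, folded L_def]
  have "\<eta> \<noteq> 0"
  proof
    assume [simp]: "\<eta> = 0"
    have "lin_step E L \<alpha> \<delta> \<zeta> \<eta> w 0 (0, u, edge_mem \<delta> \<eta> 0 u) = (0, u, edge_mem \<delta> \<eta> 0 u)" for w
      by (rule equil) (auto simp: center_balanced u)
    moreover have "pe_x E L \<delta> \<eta> (0, u, edge_mem \<delta> \<eta> 0 u) = 0"
      by (simp add: pe_x_def v_edge del: pe_v.simps)
    ultimately show False using isolated False by blast
  qed
  have "(\<Sum>i\<in>UNIV. (L *v x) $ i) = 0" for x
    using dot_lmul_matrix[of 1 L x] balanced by (simp add: inner_vec_def)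
  then have "(\<Sum>i\<in>UNIV. ((1 / \<eta>) *\<^sub>R (u - \<delta> *\<^sub>R (L *v u))) $ i) = 0"
    using u by (simp add: sum_subtractf flip: sum_distrib_left sum_divide_distrib)
  then obtain z where z: "L *v z = (1 / \<eta>) *\<^sub>R (u - \<delta> *\<^sub>R (L *v u))" "(\<Sum>i\<in>UNIV. z $ i) = 0"
    using balanced_solution[OF balanced sigma] by blast
  have Luz: "L *v (\<delta> *\<^sub>R u + \<eta> *\<^sub>R z) = u"
    using z(1) \<open>\<eta> \<noteq> 0\<close> by (simp add: matrix_vector_right_distrib matrix_vector_mult_scaleR)
  have "\<zeta> \<noteq> 0"
  proof
    assume [simp]: "\<zeta> = 0"
    have "lin_step E L \<alpha> \<delta> \<zeta> \<eta> w 0 (u, z, edge_mem \<delta> \<eta> u z) = (u, z, edge_mem \<delta> \<eta> u z)" for w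
      by (rule equil) (auto simp: Luz center_balanced z(2))
    moreover have "pe_x E L \<delta> \<eta> (u, z, edge_mem \<delta> \<eta> u z) = 0"
      by (simp add: pe_x_def v_edge Luz del: pe_v.simps)
    ultimately show False using isolated False by blast
  qed
  define c where "c = - (\<alpha> / \<zeta>)"
  have scale: "(\<Sum>i\<in>UNIV. (c *\<^sub>R x) $ i) = c * (\<Sum>i\<in>UNIV. x $ i)" for x :: "real^'n"
    by (simp add: sum_distrib_left)
  have "L *v (\<delta> *\<^sub>R (c *\<^sub>R u) + \<eta> *\<^sub>R (c *\<^sub>R z)) = c *\<^sub>R (L *v (\<delta> *\<^sub>R u + \<eta> *\<^sub>R z))"
    by (simp add: algebra_simps)
  then show ?thesis
    using \<open>\<zeta> \<noteq> 0\<close>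
    by (intro that[of "c *\<^sub>R u" "c *\<^sub>R z"]) (simp_all only: scale u z(2) Luz, simp_all add: c_def)
qed

section \<open>Projection of SH-SVL\<close>

text \<open>The edge memory of the projected model at time \<open>k\<close> is the value received at time \<open>k\<close>, shifted. So
  the projection of a state needs the set \<open>S\<close> of packets received at the current time.\<close>

definition sh_proj :: "real \<Rightarrow> real \<Rightarrow> ('n::finite \<times> 'n) set \<Rightarrow> 'n sh_state \<Rightarrow> 'n pe_state" where
  "sh_proj \<delta> \<eta> S st = (fst st, (mat 1 - avg) *v fst (snd st),
     \<chi> t. sh_r \<delta> \<eta> S st (fst t) (snd t) - \<eta> * (\<Sum>i\<in>UNIV. fst (snd st) $ i) / CARD('n))"

text \<open>The shift by a constant drops out because the rows of the Laplacian sum to zero.\<close>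

lemma sh_v_proj:
  fixes E :: "('n::finite \<times> 'n) set"
  assumes no_loops: "\<And>i. (i, i) \<notin> E"
  shows "sh_v E (laplacian E a) \<delta> \<eta> S st = pe_v E (laplacian E a) \<delta> \<eta> (sh_proj \<delta> \<eta> S st)"
proof -
  let ?L = "laplacian E a"
  obtain w1 w2 xp rp where st: "st = (w1, w2, xp, rp)" by (cases st)
  define m where "m = (\<Sum>i\<in>UNIV. w2 $ i) / CARD('n)"
  have "sh_v E ?L \<delta> \<eta> S st $ i = pe_v E ?L \<delta> \<eta> (sh_proj \<delta> \<eta> S st) $ i" for i
  proof -
    let ?r = "\<lambda>j. sh_r \<delta> \<eta> S st i j"
    have "{j. j = i \<or> (i, j) \<in> E} = insert i {j. (i, j) \<in> E}" by auto
    then have "sh_v E ?L \<delta> \<eta> S st $ i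
        = ?L $ i $ i * (\<delta> * w1 $ i + \<eta> * w2 $ i) + (\<Sum>j | (i, j) \<in> E. ?L $ i $ j * ?r j)"
      using no_loops by (simp add: sh_v_def st)
    also have "\<dots> = ?L $ i $ i * (\<delta> * w1 $ i + \<eta> * (w2 $ i - m))
        + (\<Sum>j | (i, j) \<in> E. ?L $ i $ j * (?r j - \<eta> * m))
        + \<eta> * m * (?L $ i $ i + (\<Sum>j | (i, j) \<in> E. ?L $ i $ j))"
      by (simp add: algebra_simps sum_subtractf sum_distrib_left sum_distrib_right)
    also have "\<dots> = pe_v E ?L \<delta> \<eta> (sh_proj \<delta> \<eta> S st) $ i"
      using laplacian_row_sum[OF no_loops, of a i]
      by (simp add: sh_proj_def Ebar_mult diag_part_mult st m_def matrix_vector_mult_diff_rdistrib avg_mult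
          del: sh_r.simps)
    finally show ?thesis .
  qed
  then show ?thesis by (simp add: vec_eq_iff)
qed

text \<open>The mean of \<open>w\<^sub>2\<close> grows in each step by the mean of \<open>x = w\<^sub>1 - v\<close>. This is exactly what turns
  the increment \<open>\<eta> x\<^sub>i\<close> of a lost edge into \<open>\<eta> ((I - \<Pi>) x)\<^sub>i\<close>. Equality is
  claimed only on \<open>E\<close>: an agent always receives its own value in SH-SVL, while the other model lets
  the coordinates \<open>(i, i)\<close> fail.\<close>

lemma sh_step_proj:
  fixes E :: "('n::finite \<times> 'n) set"
  assumes no_loops: "\<And>i. (i, i) \<notin> E"
  shows "pe_eq E (sh_proj \<delta> \<eta> S' (sh_step E (laplacian E a) f \<alpha> \<delta> \<zeta> \<eta> S st))
    (pe_step E (laplacian E a) f \<alpha> \<delta> \<zeta> \<eta> S' (sh_proj \<delta> \<eta> S st))"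
proof -
  let ?L = "laplacian E a" 
  obtain w1 w2 xp rp where st: "st = (w1, w2, xp, rp)" by (cases st)
  define n where "n = real CARD('n)"
  have n: "n \<noteq> 0" "real CARD('n) = n" by (auto simp: n_def)
  define m where "m = (\<Sum>i\<in>UNIV. w2 $ i) / n"
  define v where "v = pe_v E ?L \<delta> \<eta> (sh_proj \<delta> \<eta> S st)"
  define u where "u = gradF f (w1 - v)"
  define r where "r = sh_r \<delta> \<eta> S st"
  have v: "sh_v E ?L \<delta> \<eta> S st = v" unfolding v_def by (rule sh_v_proj) (rule no_loops)
  have step: "sh_step E ?L f \<alpha> \<delta> \<zeta> \<eta> S st
      = (w1 - \<alpha> *\<^sub>R u - \<zeta> *\<^sub>R v, w1 + w2 - v, w1 - v, r)"
    using v by (simp add: st Let_def sh_x_def u_def r_def)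
  have proj: "sh_proj \<delta> \<eta> S st = (w1, w2 - vec m, \<chi> t. r (fst t) (snd t) - \<eta> * m)"
    by (simp add: sh_proj_def st m_def n_def r_def matrix_vector_mult_diff_rdistrib avg_mult del: sh_r.simps)
  have center: "(mat 1 - avg) *v (w1 + (w2 - vec m) - v) = (mat 1 - avg) *v (w1 + w2 - v)"
    using center_vec[of m] by (simp add: algebra_simps) (erule sym)
  have mean: "(\<Sum>i\<in>UNIV. (w1 + w2 - v) $ i) / n = m + (\<Sum>i\<in>UNIV. (w1 - v) $ i) / n"
    using n(1) by (simp add: m_def sum.distrib sum_subtractf field_simps)
  have pe_x: "pe_x E ?L \<delta> \<eta> (sh_proj \<delta> \<eta> S st) = w1 - v"
    by (simp add: pe_x_def v_def) (simp add: proj)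
  have pe: "pe_step E ?L f \<alpha> \<delta> \<zeta> \<eta> S' (sh_proj \<delta> \<eta> S st)
     = lin_step E ?L \<alpha> \<delta> \<zeta> \<eta> S' u (sh_proj \<delta> \<eta> S st)"
    by (simp add: pe_step_eq_lin_step pe_x u_def)
  show ?thesis
    unfolding pe lin_step_def v_def[symmetric]
    unfolding step proj
    unfolding sh_proj_def pe_eq_def Let_def fst_conv snd_conv center n
  proof (intro conjI ballI)
    show "w1 - \<alpha> *\<^sub>R u - \<zeta> *\<^sub>R v = w1 - \<zeta> *\<^sub>R v - \<alpha> *\<^sub>R u" by simp
    fix t assume "t \<in> E"
    then obtain i j where t: "t = (i, j)" "i \<noteq> j" using no_loops by (cases t) auto
    have c: "((mat 1 - avg) *v x) $ k = x $ k - (\<Sum>i\<in>UNIV. x $ i) / n" for x :: "real^'n" and k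
      by (simp add: matrix_vector_mult_diff_rdistrib avg_mult n_def)
    show "(\<chi> t. sh_r \<delta> \<eta> S' (w1 - \<alpha> *\<^sub>R u - \<zeta> *\<^sub>R v, w1 + w2 - v, w1 - v, r) (fst t) (snd t)
          - \<eta> * (\<Sum>i\<in>UNIV. (w1 + w2 - v) $ i) / n) $ t
      = (\<chi> t. if t \<in> S' then \<delta> * (w1 - \<zeta> *\<^sub>R v - \<alpha> *\<^sub>R u) $ snd t
            + \<eta> * ((mat 1 - avg) *v (w1 + w2 - v)) $ snd t
          else (\<chi> t. r (fst t) (snd t) - \<eta> * m) $ t + \<eta> * ((mat 1 - avg) *v (w1 - v)) $ fst t) $ t"
      unfolding times_divide_eq_right[symmetric] mean c
      using t(2) by (simp add: t(1) algebra_simps) 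
  qed simp
qed

lemma sh_output_eq_pe_x:
  fixes E :: "('n::finite \<times> 'n) set"
  assumes no_loops: "\<And>i. (i, i) \<notin> E"
  shows "sh_output E (laplacian E a) f \<alpha> \<delta> \<zeta> \<eta> (case_nat R0 om) st0 k
    = pe_x E (laplacian E a) \<delta> \<eta>
        (pe_run E (laplacian E a) f \<alpha> \<delta> \<zeta> \<eta> om (sh_proj \<delta> \<eta> R0 st0) k)"
proof -
  let ?L = "laplacian E a"
  have "pe_eq E (sh_proj \<delta> \<eta> (case_nat R0 om k) (sh_run E ?L f \<alpha> \<delta> \<zeta> \<eta> (case_nat R0 om) st0 k))
      (pe_run E ?L f \<alpha> \<delta> \<zeta> \<eta> om (sh_proj \<delta> \<eta> R0 st0) k)"
  proof (induction k)
    case 0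
    show ?case by (simp add: pe_eq_def)
  next
    case (Suc k)
    have "pe_eq E (pe_step E ?L f \<alpha> \<delta> \<zeta> \<eta> (om k)
          (sh_proj \<delta> \<eta> (case_nat R0 om k) (sh_run E ?L f \<alpha> \<delta> \<zeta> \<eta> (case_nat R0 om) st0 k)))
        (pe_step E ?L f \<alpha> \<delta> \<zeta> \<eta> (om k) (pe_run E ?L f \<alpha> \<delta> \<zeta> \<eta> om (sh_proj \<delta> \<eta> R0 st0) k))"
      unfolding pe_step_eq_lin_step pe_eq_x[OF Suc] by (rule pe_eq_lin_step[OF Suc])
    then show ?case
      using sh_step_proj[OF no_loops, where a = a and S' = "om k"]
      unfolding sh_run.simps pe_run.simps nat.case pe_eq_def by metis
  qed
  note * = pe_eq_x[OF this]
  have "fst (sh_proj \<delta> \<eta> S st) = fst st" for S :: "('n \<times> 'n) set" and st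
    by (simp add: sh_proj_def)
  then show ?thesis
    unfolding *[symmetric] by (simp add: sh_output_def sh_x_def pe_x_def sh_v_proj[OF no_loops])
qed

section \<open>Convergence\<close>

lemma pe_run_eq_iterate:
  "pe_run E L f \<alpha> \<delta> \<zeta> \<eta> w st k = iterate (pe_step E L f \<alpha> \<delta> \<zeta> \<eta>) w st k"
  by (induction k) auto

lemma norm_pe_x_le:
  assumes "state_numbering E idx"
  obtains K where "0 \<le> K" "\<And>st. norm (pe_x E L \<delta> \<eta> st) \<le> K * norm (stack idx st)"
proof -
  have "bounded_linear ((*v) (C_mat idx E L \<delta> \<eta>))" by (rule matrix_vector_mul_bounded_linear)
  then obtain K where "\<And>\<xi>. norm (C_mat idx E L \<delta> \<eta> *v \<xi>) \<le> norm \<xi> * K" "0 \<le> K"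
    using bounded_linear.nonneg_bounded by blast
  then show ?thesis
    using system_matrices_mult_stack(2)[OF assms] by (intro that[of K]) (metis mult.commute)+
qed

text \<open>Both \<open>L\<close> and \<open>I - \<Pi>\<close> map constant vectors to \<open>0\<close>, so the optimizer drops out of the fixed point
  equations and only equations for \<open>v\<close> and \<open>w\<^sub>2\<close> remain.\<close>

lemma pe_fixed_pointI:
  fixes E :: "('n::finite \<times> 'n) set"
  assumes no_loops: "\<And>i. (i, i) \<notin> E"
    and v: "(\<Sum>i\<in>UNIV. v $ i) = 0" and w2: "(\<Sum>i\<in>UNIV. w2 $ i) = 0"
    and L: "laplacian E a *v (\<delta> *\<^sub>R v + \<eta> *\<^sub>R w2) = v"
    and u: "\<zeta> *\<^sub>R v + \<alpha> *\<^sub>R gradF f (vec xopt) = 0"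
  defines "w1 \<equiv> vec xopt + v" and "\<phi> \<equiv> edge_mem \<delta> \<eta> (vec xopt + v) w2"
  shows "pe_fixed_point E (laplacian E a) f xopt \<alpha> \<delta> \<zeta> \<eta> w1 w2 \<phi> (vec xopt) (gradF f (vec xopt))"
    and "pe_x E (laplacian E a) \<delta> \<eta> (w1, w2, \<phi>) = vec xopt"
    and "lin_step E (laplacian E a) \<alpha> \<delta> \<zeta> \<eta> w (gradF f (vec xopt)) (w1, w2, \<phi>) = (w1, w2, \<phi>)"
proof -
  let ?L = "laplacian E a"
  have kernel: "?L *v vec c = 0" for c
    using laplacian_row_sum[OF no_loops, of a]
    by (simp add: vec_eq_iff laplacian_mult[OF no_loops]) (metis distrib_right mult_zero_left sum_distrib_right)
  have Lw: "?L *v (\<delta> *\<^sub>R w1 + \<eta> *\<^sub>R w2) = v"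
  proof -
    have "?L *v (\<delta> *\<^sub>R w1 + \<eta> *\<^sub>R w2) = \<delta> *\<^sub>R (?L *v vec xopt) + ?L *v (\<delta> *\<^sub>R v + \<eta> *\<^sub>R w2)"
      by (simp add: w1_def algebra_simps)
    then show ?thesis by (simp add: kernel L)
  qed
  have pe_v: "pe_v E ?L \<delta> \<eta> (w1, w2, \<phi>) = v"
    using pe_v_edge_mem[OF no_loops, of a \<delta> \<eta> w1 w2] Lw by (simp add: \<phi>_def w1_def)
  show x: "pe_x E ?L \<delta> \<eta> (w1, w2, \<phi>) = vec xopt"
    unfolding pe_x_def pe_v by (simp add: w1_def)
  have w1: "w1 = w1 - \<zeta> *\<^sub>R v - \<alpha> *\<^sub>R gradF f (vec xopt)"
    using u by (simp add: diff_diff_eq)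
  have w2': "(mat 1 - avg) *v (w1 + w2 - v) = w2"
  proof -
    have "w1 + w2 - v = vec xopt + w2" by (simp add: w1_def)
    then show ?thesis by (simp only: matrix_vector_right_distrib center_vec center_balanced[OF w2] add_0)
  qed
  have center: "(mat 1 - avg) *v vec xopt = (0 :: real^'n)" by (rule center_vec)
  have \<phi>: "\<phi> $ (i, j) = \<delta> * w1 $ j + \<eta> * w2 $ j" for i j
    by (simp add: \<phi>_def w1_def edge_mem_def)
  show "pe_fixed_point E ?L f xopt \<alpha> \<delta> \<zeta> \<eta> w1 w2 \<phi> (vec xopt) (gradF f (vec xopt))"
    unfolding pe_fixed_point_def Let_def pe_v w2' center
    using w1 \<phi> by (auto simp: w1_def)
  show "lin_step E ?L \<alpha> \<delta> \<zeta> \<eta> w (gradF f (vec xopt)) (w1, w2, \<phi>) = (w1, w2, \<phi>)"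
    unfolding \<phi>_def w1_def[symmetric]
    by (rule lin_step_equilibrium[OF no_loops]) (simp_all only: Lw u w2', simp add: w1_def center)
qed

theorem theorem5:
  fixes f :: "'n::finite \<Rightarrow> real \<Rightarrow> real"
    and xopt \<mu> l :: real
    and E :: "('n \<times> 'n) set"
    and wt :: "'n \<Rightarrow> 'n \<Rightarrow> real"
    and L :: "real^'n^'n"
    and \<alpha> \<delta> \<zeta> \<eta> :: real
    and M :: "'w measure"
    and pl :: real
    and om :: "nat \<Rightarrow> 'w \<Rightarrow> ('n \<times> 'n) set"
    and idx :: "'s::finite \<Rightarrow> 'n coord"
    and P :: "real^'s^'s"
    and lam0 \<rho> :: real
  assumes convex: "\<And>i. convex_on UNIV (f i)"
    and differentiable: "\<And>i t. f i differentiable (at t)"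
    and argmin: "\<And>\<theta>. is_arg_min (\<lambda>\<theta>. \<Sum>i\<in>UNIV. f i \<theta>) (\<lambda>_. True) \<theta> \<longleftrightarrow> \<theta> = xopt"
    and stationary: "(\<Sum>i\<in>UNIV. deriv (f i) xopt) = 0"
    and mu_l: "0 < \<mu>" "\<mu> \<le> l"
    and sector: "\<And>i xi. let a = xi - xopt; b = deriv (f i) xi - deriv (f i) xopt
                   in - 2 * \<mu> * l * a\<^sup>2 + 2 * (l + \<mu>) * a * b - 2 * b\<^sup>2 \<ge> 0"
    and no_loops: "\<And>i. (i, i) \<notin> E"
    and connected: "strongly_connected E"
    and L_def: "L = laplacian E wt"
    and balanced: "(1 :: real^'n) v* L = 0"
    and sigma: "spectral_norm (mat 1 - avg - L) < 1"
    and prob: "prob_space M"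
    and pl: "0 \<le> pl" "pl \<le> 1"
    and indep: "prob_space.indep_vars M (\<lambda>_. count_space (Pow E)) om UNIV"
    and distr: "\<And>k w. w \<subseteq> E \<Longrightarrow> measure M {s \<in> space M. om k s = w} = loss_prob E pl w"
    and numbering: "state_numbering E idx"
    and P_pos: "pos_def P"
    and lambda0: "lam0 \<ge> 0"
    and rho: "0 < \<rho>" "\<rho> < 1"
    and lmi: "neg_semidef (lmi_matrix idx E L pl \<mu> l \<alpha> \<delta> \<zeta> \<eta> \<rho> lam0 P)"
  shows "(\<exists>w1 w2 \<phi> x u. pe_fixed_point E L f xopt \<alpha> \<delta> \<zeta> \<eta> w1 w2 \<phi> x u \<and>
            (\<forall>st0 k.
               let err = (\<lambda>s. (norm (stack idx (pe_run E L f \<alpha> \<delta> \<zeta> \<eta> (\<lambda>j. om j s) st0 k)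
                                     - stack idx (w1, w2, \<phi>)))\<^sup>2)
               in integrable M err \<and>
                  (\<integral>s. err s \<partial>M) \<le> cond_number P * \<rho> ^ (2 * k) *
                    (norm (stack idx st0 - stack idx (w1, w2, \<phi>)))\<^sup>2)) \<and>
         (\<forall>R0 st0. AE s in M. \<exists>c. \<forall>k.
            norm (sh_output E L f \<alpha> \<delta> \<zeta> \<eta> (\<lambda>j. case j of 0 \<Rightarrow> R0 s | Suc i \<Rightarrow> om i s) st0 k
                  - vec xopt) \<le> c * \<rho> ^ k)"
proof -
  interpret iid_draws M om "Pow E" "loss_prob E pl"
    by (intro iid_draws.intro iid_draws_axioms.intro prob indep distr) auto
  define Q where "Q \<xi> = \<xi> \<bullet> (P *v \<xi>)" for \<xi>
  have sym: "symmetric_matrix P" using P_pos by (simp add: pos_def_def)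
  have Q_nonneg: "0 \<le> Q \<xi>" for \<xi>
    using P_pos by (cases "\<xi> = 0") (auto simp: Q_def pos_def_def intro: less_imp_le)
  have drift: "(\<Sum>w\<in>Pow E. loss_prob E pl w * Q (stack idx (lin_step E L \<alpha> \<delta> \<zeta> \<eta> w u st)))
      \<le> \<rho>\<^sup>2 * Q (stack idx st)"
    if "\<And>i. 0 \<le> - 2 * \<mu> * l * (pe_x E L \<delta> \<eta> st $ i)\<^sup>2
           + 2 * (l + \<mu>) * (pe_x E L \<delta> \<eta> st $ i) * (u $ i) - 2 * (u $ i)\<^sup>2" for st u
  proof -
    define q where "q = lam0 * (\<Sum>i\<in>UNIV. - 2 * \<mu> * l * (pe_x E L \<delta> \<eta> st $ i)\<^sup>2
           + 2 * (l + \<mu>) * (pe_x E L \<delta> \<eta> st $ i) * (u $ i) - 2 * (u $ i)\<^sup>2)"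
    have "0 \<le> q" unfolding q_def by (intro mult_nonneg_nonneg lambda0 sum_nonneg that)
    have "(\<Sum>w\<in>Pow E. loss_prob E pl w *
        (Q (stack idx (lin_step E L \<alpha> \<delta> \<zeta> \<eta> w u st)) - \<rho>\<^sup>2 * Q (stack idx st) + q)) \<le> 0"
      unfolding q_def Q_def by (rule lmi_dissipation[OF numbering lmi])
    then have "(\<Sum>w\<in>Pow E. loss_prob E pl w * Q (stack idx (lin_step E L \<alpha> \<delta> \<zeta> \<eta> w u st)))
        - \<rho>\<^sup>2 * Q (stack idx st) + q \<le> 0"
      using sum_p by (simp add: distrib_left right_diff_distrib sum.distrib sum_subtractf flip: sum_distrib_right)
    then show ?thesis using \<open>0 \<le> q\<close> by simp
  qed
  \<comment> \<open>Zero output with zero input makes the sector term vanish, so \<open>Q \<le> \<rho>\<^sup>2 Q\<close> at an invariant state.\<close>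
  have isolated: "w1 = 0 \<and> w2 = 0"
    if "\<And>w. lin_step E L \<alpha> \<delta> \<zeta> \<eta> w 0 (w1, w2, \<phi>) = (w1, w2, \<phi>)"
      "pe_x E L \<delta> \<eta> (w1, w2, \<phi>) = 0" for w1 w2 \<phi>
  proof -
    have "Q (stack idx (w1, w2, \<phi>)) \<le> \<rho>\<^sup>2 * Q (stack idx (w1, w2, \<phi>))"
      using drift[of "(w1, w2, \<phi>)" 0] that sum_p by (simp del: stack.simps flip: sum_distrib_right)
    moreover have "\<rho>\<^sup>2 < 1" using rho by (simp add: power_less_one_iff)
    ultimately have "Q (stack idx (w1, w2, \<phi>)) = 0"
      using Q_nonneg[of "stack idx (w1, w2, \<phi>)"]
      by (smt (verit) mult_le_cancel_right1)
    then have "stack idx (w1, w2, \<phi>) = 0"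
      using P_pos unfolding pos_def_def Q_def by force
    then show ?thesis using stack_eq_0D[OF numbering] by blast
  qed
  have grad_sum: "(\<Sum>i\<in>UNIV. gradF f (vec xopt) $ i) = 0"
    using stationary by (simp add: gradF_def)
  obtain v w2 where vw: "(\<Sum>i\<in>UNIV. v $ i) = 0" "(\<Sum>i\<in>UNIV. w2 $ i) = 0"
    "L *v (\<delta> *\<^sub>R v + \<eta> *\<^sub>R w2) = v" "\<zeta> *\<^sub>R v + \<alpha> *\<^sub>R gradF f (vec xopt) = 0"
    by (rule equilibrium_exists[OF no_loops L_def balanced sigma grad_sum, of \<alpha> \<delta> \<zeta> \<eta>])
      (use isolated in blast)+
  define w1 where "w1 = vec xopt + v"
  define \<phi> where "\<phi> = edge_mem \<delta> \<eta> w1 w2"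
  note fp = pe_fixed_pointI[OF no_loops vw(1,2) vw(3)[unfolded L_def] vw(4),
      folded L_def w1_def, folded \<phi>_def]
  define st' where "st' = (w1, w2, \<phi>)"
  define V where "V st = Q (stack idx st - stack idx st')" for st
  \<comment> \<open>The deviation from the fixed point is a state of the linear system, driven by the deviation of
      the gradient from its value at the optimizer; the sector condition concerns exactly this pair.\<close>
  have contraction: "(\<Sum>w\<in>Pow E. loss_prob E pl w * V (pe_step E L f \<alpha> \<delta> \<zeta> \<eta> w st)) \<le> \<rho>\<^sup>2 * V st" for st
  proof -
    let ?x = "pe_x E L \<delta> \<eta> st"
    have step: "stack idx (pe_step E L f \<alpha> \<delta> \<zeta> \<eta> w st) - stack idx st'
        = stack idx (lin_step E L \<alpha> \<delta> \<zeta> \<eta> w (gradF f ?x - gradF f (vec xopt)) (st - st'))" for w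
      using fp(3)[of w] by (simp add: lin_step_diff stack_diff pe_step_eq_lin_step st'_def del: stack.simps)
    have x: "pe_x E L \<delta> \<eta> (st - st') = ?x - vec xopt"
      by (simp add: pe_x_diff st'_def fp(2))
    show ?thesis
      unfolding V_def step
      unfolding stack_diff[symmetric]
    proof (rule drift)
      fix i
      show "0 \<le> - 2 * \<mu> * l * (pe_x E L \<delta> \<eta> (st - st') $ i)\<^sup>2
           + 2 * (l + \<mu>) * (pe_x E L \<delta> \<eta> (st - st') $ i) * ((gradF f ?x - gradF f (vec xopt)) $ i)
           - 2 * ((gradF f ?x - gradF f (vec xopt)) $ i)\<^sup>2"
        using sector[of "?x $ i" i] by (simp add: x gradF_def Let_def)
    qed
  qed
  have V_nonneg: "0 \<le> V st" for st unfolding V_def by (rule Q_nonneg)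
  let ?run = "\<lambda>st0 s k. pe_run E L f \<alpha> \<delta> \<zeta> \<eta> (\<lambda>j. om j s) st0 k"
  define lmin where "lmin = Min (eigenvalues P)"
  define lmax where "lmax = Max (eigenvalues P)"
  have lmin: "0 < lmin" unfolding lmin_def by (rule Min_eigenvalue_pos[OF P_pos])
  have lower: "lmin * (norm (stack idx st - stack idx st'))\<^sup>2 \<le> V st" for st
    unfolding V_def Q_def lmin_def by (rule Min_eigenvalue_le_rayleigh[OF sym])
  have upper: "V st \<le> lmax * (norm (stack idx st - stack idx st'))\<^sup>2" for st
    unfolding V_def Q_def lmax_def by (rule rayleigh_le_Max_eigenvalue[OF sym])
  have mean_square: "integrable M (\<lambda>s. (norm (stack idx (?run st0 s k) - stack idx st'))\<^sup>2) \<and>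
      (\<integral>s. (norm (stack idx (?run st0 s k) - stack idx st'))\<^sup>2 \<partial>M) \<le> cond_number P * \<rho> ^ (2 * k) *
         (norm (stack idx st0 - stack idx st'))\<^sup>2" for st0 k
  proof
    show int: "integrable M (\<lambda>s. (norm (stack idx (?run st0 s k) - stack idx st'))\<^sup>2)"
      unfolding pe_run_eq_iterate by (rule integrable_traj)
    have "lmin * (\<integral>s. (norm (stack idx (?run st0 s k) - stack idx st'))\<^sup>2 \<partial>M)
        = (\<integral>s. lmin * (norm (stack idx (?run st0 s k) - stack idx st'))\<^sup>2 \<partial>M)"
      by simp
    also have "\<dots> \<le> (\<integral>s. V (?run st0 s k) \<partial>M)"
      by (intro integral_mono integrable_mult_right int lower)
        (unfold pe_run_eq_iterate, rule integrable_traj)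
    also have "\<dots> \<le> (\<rho>\<^sup>2) ^ k * V st0"
      unfolding pe_run_eq_iterate by (rule expectation_traj_le[OF contraction]) simp
    also have "\<dots> \<le> (\<rho>\<^sup>2) ^ k * (lmax * (norm (stack idx st0 - stack idx st'))\<^sup>2)"
      by (intro mult_left_mono upper) simp
    finally show "(\<integral>s. (norm (stack idx (?run st0 s k) - stack idx st'))\<^sup>2 \<partial>M)
        \<le> cond_number P * \<rho> ^ (2 * k) * (norm (stack idx st0 - stack idx st'))\<^sup>2"
      using lmin unfolding power_mult cond_number_def lmin_def[symmetric] lmax_def[symmetric]
      by (simp add: field_simps)
  qed
  obtain K where K: "0 \<le> K" "\<And>st. norm (pe_x E L \<delta> \<eta> st) \<le> K * norm (stack idx st)"
    using norm_pe_x_le[OF numbering] by blast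
  have path: "AE s in M. \<exists>c. \<forall>k. norm (pe_x E L \<delta> \<eta> (?run st0 s k) - vec xopt) \<le> c * \<rho> ^ k" for st0
  proof -
    have "AE s in M. \<exists>b. \<forall>k. V (?run st0 s k) \<le> b * (\<rho>\<^sup>2) ^ k"
      unfolding pe_run_eq_iterate by (rule AE_traj_bounded[OF V_nonneg contraction]) (use rho in simp)
    then show ?thesis
    proof eventually_elim
      case (elim s)
      then obtain b where b: "V (?run st0 s k) \<le> b * (\<rho>\<^sup>2) ^ k" for k by blast
      have "norm (pe_x E L \<delta> \<eta> (?run st0 s k) - vec xopt) \<le> (K * sqrt (b / lmin)) * \<rho> ^ k" for k
      proof -
        have "lmin * (norm (stack idx (?run st0 s k) - stack idx st'))\<^sup>2 \<le> b * (\<rho>\<^sup>2) ^ k"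
          by (rule order_trans[OF lower b])
        then have "(norm (stack idx (?run st0 s k) - stack idx st'))\<^sup>2 \<le> (b / lmin) * (\<rho> ^ k)\<^sup>2"
          using lmin by (simp add: field_simps flip: power_mult)
        then have "sqrt ((norm (stack idx (?run st0 s k) - stack idx st'))\<^sup>2)
            \<le> sqrt ((b / lmin) * (\<rho> ^ k)\<^sup>2)"
          by (rule real_sqrt_le_mono)
        also have "\<dots> = sqrt (b / lmin) * \<rho> ^ k"
          using rho by (simp only: real_sqrt_mult real_sqrt_abs) simp
        finally have bound: "norm (stack idx (?run st0 s k) - stack idx st') \<le> sqrt (b / lmin) * \<rho> ^ k"
          by simp
        have "norm (pe_x E L \<delta> \<eta> (?run st0 s k) - vec xopt)
            \<le> K * norm (stack idx (?run st0 s k) - stack idx st')"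
          using K(2)[of "?run st0 s k - st'"]
          by (simp add: pe_x_diff stack_diff st'_def fp(2) del: stack.simps)
        also have "\<dots> \<le> K * (sqrt (b / lmin) * \<rho> ^ k)"
          by (rule mult_left_mono[OF bound K(1)])
        finally show ?thesis by (simp add: mult.assoc)
      qed
      then show ?case by blast
    qed
  qed
  have "AE s in M. \<exists>c. \<forall>k.
      norm (sh_output E L f \<alpha> \<delta> \<zeta> \<eta> (case_nat (R0 s) (\<lambda>i. om i s)) st0 k - vec xopt) \<le> c * \<rho> ^ k" for R0 st0
  proof -
    \<comment> \<open>The packets received at time 0 may depend on the outcome in any way, even nonmeasurably. They
        only select one of finitely many initial states of the projected model, so an almost sure
        event common to all of them suffices.\<close>
    have "AE s in M. \<forall>R\<in>UNIV. \<exists>c. \<forall>k.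
        norm (pe_x E L \<delta> \<eta> (?run (sh_proj \<delta> \<eta> R st0) s k) - vec xopt) \<le> c * \<rho> ^ k"
      by (intro AE_finite_allI finite path)
    then show ?thesis
      by eventually_elim (simp add: L_def sh_output_eq_pe_x[OF no_loops])
  qed
  then show ?thesis
    using fp(1) mean_square unfolding st'_def Let_def by blast
qed

end
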